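(* A function $q\colon\mathbb{C}\setminus\mathbb{R}\to\mathbb{C}$ is a quasi-Herglotz function if and only if $q$ can be written, for every $z\in\mathbb{C}\setminus\mathbb{R}$, as $$q(z)=a+b\,z+\frac{1}{\pi}\int_{\mathbb{R}}\frac{1+t\,z}{t-z}\,\mathrm{d}\nu(t),$$ where $a,b\in\mathbb{C}$ and $\nu$ is a complex Borel measure on $\mathbb{R}$. Furthermore, this representation is unique, i.e. each quasi-Herglotz function $q$ is associated with exactly one triple $(a,b,\nu)$ of this kind.
   Context: A Herglotz function is a holomorphic function $h\colon\mathbb{C}\setminus\mathbb{R}\to\mathbb{C}$ with $\frac{\operatorname{Im}[h(z)]}{\operatorname{Im}[z]}\ge 0$ and $\overline{h(z)}=h(\overline{z})$ for all $z\in\mathbb{C}\setminus\mathbb{R}$. A function $q\colon\mathbb{C}\setminus\mathbb{R}\to\mathbb{C}$ is a quasi-Herglotz function if there exist Herglotz functions $h_1,h_2,h_3,h_4$ such that $q(z)=(h_1-h_2)(z)+\mathrm{i}\,(h_3-h_4)(z)$ for all $z\in\mathbb{C}\setminus\mathbb{R}$. A complex Borel measure is finite by definition. *)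

theory Defs
  imports "HOL-Complex_Analysis.Complex_Analysis"
begin

section \<open>Herglotz and quasi-Herglotz functions\<close>

text \<open>
  Functions on \<open>\<complex> - \<real>\<close> are modelled as total functions \<^typ>\<open>complex \<Rightarrow> complex\<close> of which only the
  values on \<^term>\<open>- \<real> :: complex set\<close> are relevant.
\<close>

definition herglotz :: "(complex \<Rightarrow> complex) \<Rightarrow> bool" where
  "herglotz h \<longleftrightarrow>
     h holomorphic_on - \<real> \<and>
     (\<forall>z \<in> - \<real>. Im (h z) / Im z \<ge> 0 \<and> cnj (h z) = h (cnj z))"

definition quasi_herglotz :: "(complex \<Rightarrow> complex) \<Rightarrow> bool" where
  "quasi_herglotz q \<longleftrightarrow>
     (\<exists>h1 h2 h3 h4. herglotz h1 \<and> herglotz h2 \<and> herglotz h3 \<and> herglotz h4 \<and>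
        (\<forall>z \<in> - \<real>. q z = (h1 z - h2 z) + \<i> * (h3 z - h4 z)))"

section \<open>Complex measures and integration against them\<close>

text \<open>
  A complex measure on the measurable space underlying \<open>M\<close> (the measure carried by \<open>M\<close> is ignored)
  is a countably additive function on \<^term>\<open>sets M\<close> with values in the complex numbers; finiteness
  is built into the type of its values, and \<open>\<nu> {} = 0\<close> follows from the convergence of the series for
  the constant sequence \<open>{}\<close>. As for \<^const>\<open>emeasure\<close>, the value on non-measurable sets is fixed
  to be \<open>0\<close>, so that equality of complex measures is equality of functions.
\<close>

definition complex_measure :: "'a measure \<Rightarrow> ('a set \<Rightarrow> complex) \<Rightarrow> bool" where
  "complex_measure M \<nu> \<longleftrightarrow>
     (\<forall>A :: nat \<Rightarrow> 'a set. range A \<subseteq> sets M \<longrightarrow> disjoint_family A \<longrightarrow>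
        (\<lambda>i. \<nu> (A i)) sums \<nu> (\<Union>i. A i)) \<and>
     (\<forall>A. A \<notin> sets M \<longrightarrow> \<nu> A = 0)"

text \<open>
  The upper variation \<open>E \<mapsto> sup {\<mu> A | A measurable, A \<subseteq> E}\<close> of a signed measure \<open>\<mu>\<close>, i.e. the positive
  part of its Jordan decomposition; the negative part is the upper variation of \<open>- \<mu>\<close>.
  The truncation of negative numbers by \<^const>\<open>ennreal\<close> does not affect the supremum, to which
  \<open>A = {}\<close> already contributes \<open>0\<close>.
\<close>

definition upper_variation :: "'a measure \<Rightarrow> ('a set \<Rightarrow> real) \<Rightarrow> 'a measure" where
  "upper_variation M \<mu> =
     measure_of (space M) (sets M) (\<lambda>E. SUP A \<in> {A \<in> sets M. A \<subseteq> E}. ennreal (\<mu> A))"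

definition signed_measure_integral ::
    "'a measure \<Rightarrow> ('a set \<Rightarrow> real) \<Rightarrow> ('a \<Rightarrow> complex) \<Rightarrow> complex" where
  "signed_measure_integral M \<mu> f =
     integral\<^sup>L (upper_variation M \<mu>) f - integral\<^sup>L (upper_variation M (\<lambda>A. - \<mu> A)) f"

definition complex_measure_integral ::
    "'a measure \<Rightarrow> ('a set \<Rightarrow> complex) \<Rightarrow> ('a \<Rightarrow> complex) \<Rightarrow> complex" where
  "complex_measure_integral M \<nu> f =
     signed_measure_integral M (\<lambda>A. Re (\<nu> A)) f +
     \<i> * signed_measure_integral M (\<lambda>A. Im (\<nu> A)) f"

section \<open>The integral representation\<close>

definition integral_representation ::
    "(complex \<Rightarrow> complex) \<Rightarrow> complex \<Rightarrow> complex \<Rightarrow> (real set \<Rightarrow> complex) \<Rightarrow> bool" where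
  "integral_representation q a b \<nu> \<longleftrightarrow>
     (\<forall>z \<in> - \<real>. q z = a + b * z + 1 / of_real pi *
        complex_measure_integral borel \<nu> (\<lambda>t. (1 + of_real t * z) / (of_real t - z)))"

end

theory Submission
  imports Defs "HOL-Probability.Helly_Selection" "HOL-Real_Asymp.Real_Asymp"
begin

text \<open>
  The substance of the theorem is Herglotz's representation of a function with nonnegative
  imaginary part in the upper half-plane; the rest is the Jordan decomposition and Stieltjes inversion.

  \<^emph>\<open>Existence.\<close> A Cayley transform turns a Herglotz function \<open>h\<close> into a holomorphic function \<open>F\<close> with
  nonnegative real part on the unit disc. On a circle of radius \<open>r < 1\<close> the Schwarz formula recovers
  \<open>F (r w)\<close> from the nonnegative density \<open>Re (F (r e))\<close>, where \<open>e\<close> runs over the unit circle; all these densities have the same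
  total mass \<open>Re (F 0)\<close>. Helly's selection theorem yields a weak limit as \<open>r\<close> tends to \<open>1\<close>, and the
  Schwarz kernel is bounded and continuous, so that the formula survives in the limit
  (\<open>Riesz_Herglotz_disc\<close>). Transported back to the half-plane, the Schwarz kernel becomes
  \<open>(1 + t z) / (t - z)\<close>, and the mass sitting at the point of the circle that corresponds to
  infinity becomes the coefficient of \<open>z\<close> (\<open>herglotz_representation\<close>). Reflection gives the formula
  in the lower half-plane. A quasi-Herglotz function is a complex combination of four Herglotz
  functions, and the same combination of their measures is a complex measure.

  \<^emph>\<open>Converse.\<close> A complex measure splits into four finite positive ones, by the Jordan decomposition
  of its real and imaginary part. For a finite positive measure, a real constant and a
  nonnegative linear coefficient the representing formula visibly defines a Herglotz function
  (\<open>herglotz_of_representation\<close>).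

  \<^emph>\<open>Uniqueness.\<close> Since \<open>(1 + t z) / (t - z) = z + (1 + z\<^sup>2) / (t - z)\<close>, the values at \<open>\<i>\<close> and
  \<open>- \<i>\<close> determine \<open>a\<close> and \<open>b + \<nu> UNIV / \<pi>\<close>. The remaining values therefore determine the Cauchy
  transform of \<open>\<nu>\<close>, hence by Stieltjes inversion \<open>\<nu>\<close> itself (\<open>complex_measure_eqI_Cauchy\<close>), and
  finally \<open>b\<close>. It is essential here that both half-planes are available: the difference of the
  transform at \<open>z\<close> and at its conjugate isolates the Poisson integral of a measure that need not
  be real.
\<close>

section \<open>Jordan decomposition of a signed measure\<close>

text \<open>
  Real-valued countable additivity, in the shape that the real and imaginary part of a
  \<^const>\<open>complex_measure\<close> inherit.
\<close>
definition signed_measure :: "'a measure \<Rightarrow> ('a set \<Rightarrow> real) \<Rightarrow> bool" where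
  "signed_measure M \<mu> \<longleftrightarrow>
     (\<forall>A :: nat \<Rightarrow> 'a set. range A \<subseteq> sets M \<longrightarrow> disjoint_family A \<longrightarrow> (\<lambda>i. \<mu> (A i)) sums \<mu> (\<Union>i. A i))"

lemma signed_measureD:
  "signed_measure M \<mu> \<Longrightarrow> range A \<subseteq> sets M \<Longrightarrow> disjoint_family A \<Longrightarrow> (\<lambda>i. \<mu> (A i)) sums \<mu> (\<Union>i::nat. A i)"
  by (simp add: signed_measure_def)

lemma signed_measure_empty:
  assumes "signed_measure M \<mu>" shows "\<mu> {} = 0"
proof -
  have "(\<lambda>i::nat. \<mu> {}) sums \<mu> {}"
    using signed_measureD[OF assms, of "\<lambda>_. {}"] by (simp add: disjoint_family_on_def)
  then have "summable (\<lambda>i::nat. \<mu> {})" by (rule sums_summable)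
  then show ?thesis by (simp add: summable_const_iff)
qed

lemma signed_measure_Un:
  assumes "signed_measure M \<mu>" "A \<in> sets M" "B \<in> sets M" "A \<inter> B = {}"
  shows "\<mu> (A \<union> B) = \<mu> A + \<mu> B"
proof -
  have "(\<lambda>i. \<mu> (binaryset A B i)) sums \<mu> (\<Union>i. binaryset A B i)"
    using assms by (intro signed_measureD[OF assms(1)]) (auto simp: range_binaryset_eq disjoint_family_on_def binaryset_def)
  moreover have "(\<lambda>i. \<mu> (binaryset A B i)) sums (\<mu> A + \<mu> B)"
    by (rule binaryset_sums) (rule signed_measure_empty[OF assms(1)])
  ultimately show ?thesis
    by (simp add: UN_binaryset_eq sums_unique2)
qed

lemma signed_measure_uminus:
  "signed_measure M \<mu> \<Longrightarrow> signed_measure M (\<lambda>A. - \<mu> A)"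
  by (auto simp: signed_measure_def intro: sums_minus)

text \<open>
  The set function from which \<^const>\<open>upper_variation\<close> is built. It has to be shown to be a measure
  before anything can be said about \<^const>\<open>upper_variation\<close> itself.
\<close>
definition upper_variation_fun :: "'a measure \<Rightarrow> ('a set \<Rightarrow> real) \<Rightarrow> 'a set \<Rightarrow> ennreal" where
  "upper_variation_fun M \<mu> E = (SUP A \<in> {A \<in> sets M. A \<subseteq> E}. ennreal (\<mu> A))"

lemma upper_variation_fun_upper: "A \<in> sets M \<Longrightarrow> A \<subseteq> E \<Longrightarrow> ennreal (\<mu> A) \<le> upper_variation_fun M \<mu> E"
  unfolding upper_variation_fun_def by (rule SUP_upper) auto

lemma upper_variation_fun_mono: "E \<subseteq> F \<Longrightarrow> upper_variation_fun M \<mu> E \<le> upper_variation_fun M \<mu> F"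
  unfolding upper_variation_fun_def by (rule SUP_subset_mono) auto

lemma SUP_add_SUP_le_ennreal:
  fixes f :: "'a \<Rightarrow> ennreal" and g :: "'b \<Rightarrow> ennreal"
  assumes "I \<noteq> {}" "J \<noteq> {}" "\<And>i j. i \<in> I \<Longrightarrow> j \<in> J \<Longrightarrow> f i + g j \<le> c"
  shows "(SUP i\<in>I. f i) + (SUP j\<in>J. g j) \<le> c"
proof -
  have "(SUP i\<in>I. f i) + (SUP j\<in>J. g j) = (SUP i\<in>I. f i + (SUP j\<in>J. g j))"
    by (rule ennreal_SUP_add_left[symmetric]) fact
  also have "\<dots> = (SUP i\<in>I. SUP j\<in>J. f i + g j)"
    using assms(2) by (simp add: ennreal_SUP_add_right)
  also have "\<dots> \<le> c"
    using assms(3) by (intro SUP_least)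
  finally show ?thesis .
qed

text \<open>
  A subset of a disjoint union splits into its traces on the pieces, which gives one inequality.
  Conversely, subsets of finitely many pieces can be united into a single competitor for the union
  of the pieces; a subset of negative value contributes \<open>0\<close> because of the truncation by \<^const>\<open>ennreal\<close> and is
  left out of the union.
\<close>
lemma upper_variation_fun_countably_additive:
  assumes \<mu>: "signed_measure M \<mu>"
  shows "countably_additive (sets M) (upper_variation_fun M \<mu>)"
proof (rule countably_additiveI)
  fix E :: "nat \<Rightarrow> 'a set"
  assume E: "range E \<subseteq> sets M" "disjoint_family E" "\<Union> (range E) \<in> sets M"
  show "(\<Sum>i. upper_variation_fun M \<mu> (E i)) = upper_variation_fun M \<mu> (\<Union> (range E))"
  proof (rule antisym)
    show "upper_variation_fun M \<mu> (\<Union> (range E)) \<le> (\<Sum>i. upper_variation_fun M \<mu> (E i))"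
      unfolding upper_variation_fun_def[of M \<mu> "\<Union> (range E)"]
    proof (rule SUP_least, clarsimp)
      fix A assume A: "A \<in> sets M" "A \<subseteq> \<Union> (range E)"
      have "(\<lambda>i. \<mu> (A \<inter> E i)) sums \<mu> (\<Union>i. A \<inter> E i)"
        using E A by (intro signed_measureD[OF \<mu>]) (auto simp: disjoint_family_on_def)
      moreover have "(\<Union>i. A \<inter> E i) = A" using A by auto
      ultimately have s: "(\<lambda>i. \<mu> (A \<inter> E i)) sums \<mu> A" by simp
      show "ennreal (\<mu> A) \<le> (\<Sum>i. upper_variation_fun M \<mu> (E i))"
      proof (rule LIMSEQ_le_const2)
        show "(\<lambda>n. ennreal (\<Sum>i<n. \<mu> (A \<inter> E i))) \<longlonglongrightarrow> ennreal (\<mu> A)"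
          using s by (intro tendsto_ennrealI) (simp add: sums_def)
        show "\<exists>N. \<forall>n\<ge>N. ennreal (\<Sum>i<n. \<mu> (A \<inter> E i)) \<le> (\<Sum>i. upper_variation_fun M \<mu> (E i))"
        proof (intro exI allI impI)
          fix n
          have "ennreal (\<Sum>i<n. \<mu> (A \<inter> E i)) \<le> ennreal (\<Sum>i<n. max 0 (\<mu> (A \<inter> E i)))"
            by (intro ennreal_leI sum_mono) auto
          also have "\<dots> = (\<Sum>i<n. ennreal (max 0 (\<mu> (A \<inter> E i))))"
            by (rule sum_ennreal[symmetric]) auto
          also have "\<dots> \<le> (\<Sum>i<n. upper_variation_fun M \<mu> (E i))"
            using A E by (intro sum_mono) (auto simp: max_def intro!: upper_variation_fun_upper)
          also have "\<dots> \<le> (\<Sum>i. upper_variation_fun M \<mu> (E i))"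
            by (rule sum_le_suminf) auto
          finally show "ennreal (\<Sum>i<n. \<mu> (A \<inter> E i)) \<le> (\<Sum>i. upper_variation_fun M \<mu> (E i))" .
        qed
      qed
    qed
  next
    have "(\<Sum>i<n. upper_variation_fun M \<mu> (E i)) \<le> upper_variation_fun M \<mu> (\<Union>i<n. E i)" for n
    proof (induction n)
      case (Suc n)
      have "upper_variation_fun M \<mu> (\<Union>i<n. E i) + upper_variation_fun M \<mu> (E n) \<le> upper_variation_fun M \<mu> (\<Union>i<Suc n. E i)"
        unfolding upper_variation_fun_def[of M \<mu> "\<Union>i<n. E i"] upper_variation_fun_def[of M \<mu> "E n"]
      proof (rule SUP_add_SUP_le_ennreal; clarsimp?)
        fix A B assume A: "A \<in> sets M" "A \<subseteq> (\<Union>i<n. E i)" and B: "B \<in> sets M" "B \<subseteq> E n"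
        have "E i \<inter> E n = {}" if "i < n" for i
          using E(2) that by (auto simp: disjoint_family_on_def)
        then have dis: "A \<inter> B = {}" using A B by fastforce
        have *: "C \<in> sets M \<and> C \<subseteq> (\<Union>i<Suc n. E i) \<Longrightarrow> ennreal (\<mu> C) \<le> upper_variation_fun M \<mu> (\<Union>i<Suc n. E i)" for C
          by (auto intro: upper_variation_fun_upper)
        have Au: "A \<subseteq> (\<Union>i<Suc n. E i)" "B \<subseteq> (\<Union>i<Suc n. E i)" using A B by (auto simp: lessThan_Suc)
        show "ennreal (\<mu> A) + ennreal (\<mu> B) \<le> upper_variation_fun M \<mu> (\<Union>i<Suc n. E i)"
        proof (cases "0 \<le> \<mu> A \<and> 0 \<le> \<mu> B")
          case True
          then have "ennreal (\<mu> A) + ennreal (\<mu> B) = ennreal (\<mu> (A \<union> B))"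
            using signed_measure_Un[OF \<mu> A(1) B(1) dis] by (simp add: ennreal_plus)
          also have "\<dots> \<le> upper_variation_fun M \<mu> (\<Union>i<Suc n. E i)"
            using A B Au by (intro *) auto
          finally show ?thesis .
        next
          case False
          then have "ennreal (\<mu> A) + ennreal (\<mu> B) = ennreal (\<mu> A) \<or> ennreal (\<mu> A) + ennreal (\<mu> B) = ennreal (\<mu> B)"
            by (auto simp: ennreal_neg)
          then show ?thesis
            using *[of A] *[of B] A B Au by auto
        qed
      qed (auto intro: exI[of _ "{}"])
      moreover have "(\<Sum>i<Suc n. upper_variation_fun M \<mu> (E i)) \<le> upper_variation_fun M \<mu> (\<Union>i<n. E i) + upper_variation_fun M \<mu> (E n)"
        using add_right_mono[OF Suc.IH] by simp
      ultimately show ?case by (rule order_trans[rotated])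
    qed simp
    moreover have "upper_variation_fun M \<mu> (\<Union>i<n. E i) \<le> upper_variation_fun M \<mu> (\<Union> (range E))" for n
      by (rule upper_variation_fun_mono) auto
    ultimately have "(\<Sum>i<n. upper_variation_fun M \<mu> (E i)) \<le> upper_variation_fun M \<mu> (\<Union> (range E))" for n
      by (rule order_trans)
    then show "(\<Sum>i. upper_variation_fun M \<mu> (E i)) \<le> upper_variation_fun M \<mu> (\<Union> (range E))"
      by (intro suminf_le_const summableI)
  qed
qed

lemma sets_upper_variation[simp]: "sets (upper_variation M \<mu>) = sets M"
  and space_upper_variation[simp]: "space (upper_variation M \<mu>) = space M"
  by (simp_all add: upper_variation_def)

lemma emeasure_upper_variation:
  assumes \<mu>: "signed_measure M \<mu>" and E: "E \<in> sets M"
  shows "emeasure (upper_variation M \<mu>) E = upper_variation_fun M \<mu> E"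
proof -
  have "positive (sets M) (upper_variation_fun M \<mu>)"
  proof -
    have "{A \<in> sets M. A \<subseteq> {}} = {{}}" by auto
    then show ?thesis by (simp add: positive_def upper_variation_fun_def signed_measure_empty[OF \<mu>])
  qed
  then show ?thesis
    unfolding upper_variation_def upper_variation_fun_def[symmetric]
    using E by (intro emeasure_measure_of_sigma upper_variation_fun_countably_additive \<mu>) (auto intro: sets.sigma_algebra_axioms)
qed

text \<open>
  If a set \<open>E\<close> had infinite upper variation, some \<open>A \<subseteq> E\<close> would have value above
  \<open>1 + \<bar>\<mu> E\<bar>\<close>, so that both \<open>A\<close> and \<open>E - A\<close> have absolute value above \<open>1\<close>, while one of them still
  has infinite upper variation. Iterating leaves behind infinitely many disjoint sets of absolute
  value above \<open>1\<close>, which contradicts the convergence of the series of their values.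
\<close>
lemma finite_measure_upper_variation:
  assumes \<mu>: "signed_measure M \<mu>"
  shows "finite_measure (upper_variation M \<mu>)"
proof
  let ?V = "upper_variation M \<mu>"
  show "emeasure ?V (space ?V) \<noteq> \<infinity>"
  proof
    assume top: "emeasure ?V (space ?V) = \<infinity>"
    define P where "P E \<longleftrightarrow> E \<in> sets M \<and> emeasure ?V E = \<infinity>" for E
    have step: "\<exists>F. P F \<and> F \<subseteq> E \<and> \<bar>\<mu> (E - F)\<bar> > 1" if "P E" for E
    proof -
      have E: "E \<in> sets M" "upper_variation_fun M \<mu> E = \<infinity>"
        using that by (auto simp: P_def emeasure_upper_variation[OF \<mu>])
      then have "\<exists>A\<in>{A \<in> sets M. A \<subseteq> E}. ennreal (1 + \<bar>\<mu> E\<bar>) < ennreal (\<mu> A)"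
        unfolding less_SUP_iff[symmetric] upper_variation_fun_def[symmetric] by (simp del: ennreal_plus)
      then obtain A where A: "A \<in> sets M" "A \<subseteq> E" "1 + \<bar>\<mu> E\<bar> < \<mu> A"
        by (auto simp: ennreal_less_iff simp del: ennreal_plus)
      have eq: "\<mu> E = \<mu> A + \<mu> (E - A)"
        using signed_measure_Un[OF \<mu> A(1), of "E - A"] A E by (simp add: Un_absorb1)
      have "emeasure ?V A + emeasure ?V (E - A) = emeasure ?V E"
        using A E by (subst plus_emeasure) (auto simp: Un_absorb1)
      then have "emeasure ?V A = \<infinity> \<or> emeasure ?V (E - A) = \<infinity>"
        using that unfolding P_def infinity_ennreal_def by (simp only: ennreal_add_eq_top)
      then consider "emeasure ?V A = \<infinity>" | "emeasure ?V (E - A) = \<infinity>" by blast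
      then show ?thesis
      proof cases
        case 1
        then show ?thesis using A E eq by (intro exI[of _ A]) (auto simp: P_def)
      next
        case 2
        moreover have "E - (E - A) = A" using A by auto
        ultimately show ?thesis using A E eq by (intro exI[of _ "E - A"]) (auto simp: P_def)
      qed
    qed
    have "P (space M)" using top by (simp add: P_def)
    then obtain F where F: "\<And>n. P (F n) \<and> F (Suc n) \<subseteq> F n \<and> \<bar>\<mu> (F n - F (Suc n))\<bar> > 1"
      using dependent_nat_choice[of "\<lambda>_. P" "\<lambda>_ E F. F \<subseteq> E \<and> \<bar>\<mu> (E - F)\<bar> > 1"] step by blast
    have dec: "decseq F" using F by (simp add: decseq_Suc_iff)
    have dis: "disjoint_family (\<lambda>n. F n - F (Suc n))"
    proof -
      have "(F m - F (Suc m)) \<inter> (F n - F (Suc n)) = {}" if "m < n" for m n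
        using decseqD[OF dec, of "Suc m" n] that by auto
      then show ?thesis
        by (auto simp: disjoint_family_on_def) (metis DiffI IntI empty_iff linorder_neqE_nat)
    qed
    have "(\<lambda>n. \<mu> (F n - F (Suc n))) sums \<mu> (\<Union>n. F n - F (Suc n))"
      using F by (intro signed_measureD[OF \<mu>] dis) (auto simp: P_def)
    then have "(\<lambda>n. \<mu> (F n - F (Suc n))) \<longlonglongrightarrow> 0"
      by (intro summable_LIMSEQ_zero) (rule sums_summable)
    then have "\<forall>\<^sub>F n in sequentially. \<bar>\<mu> (F n - F (Suc n))\<bar> < 1"
      by (auto simp: tendsto_iff dist_real_def)
    then obtain n where "\<bar>\<mu> (F n - F (Suc n))\<bar> < 1"
      using eventually_happens by fastforce
    then show False
      using F[of n] by simp
  qed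
qed

text \<open>
  Passing from \<open>A \<subseteq> E\<close> to \<open>E - A\<close> shows that the suprema for \<open>\<mu>\<close> and for
  \<open>- \<mu>\<close> over the subsets of \<open>E\<close> differ by exactly \<open>\<mu> E\<close>.
\<close>
lemma jordan_decomposition:
  assumes \<mu>: "signed_measure M \<mu>" and E: "E \<in> sets M"
  shows "\<mu> E = measure (upper_variation M \<mu>) E - measure (upper_variation M (\<lambda>A. - \<mu> A)) E"
proof -
  have le: "measure (upper_variation M \<nu>) E \<le> measure (upper_variation M (\<lambda>A. - \<nu> A)) E + \<nu> E"
    if \<nu>: "signed_measure M \<nu>" for \<nu>
  proof -
    note \<nu>' = signed_measure_uminus[OF \<nu>]
    interpret N: finite_measure "upper_variation M \<nu>" by (rule finite_measure_upper_variation[OF \<nu>])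
    interpret N': finite_measure "upper_variation M (\<lambda>A. - \<nu> A)" by (rule finite_measure_upper_variation[OF \<nu>'])
    have "\<nu> A \<le> measure (upper_variation M (\<lambda>A. - \<nu> A)) E + \<nu> E" if A: "A \<in> sets M" "A \<subseteq> E" for A
    proof -
      have "\<nu> E = \<nu> A + \<nu> (E - A)"
        using signed_measure_Un[OF \<nu> A(1), of "E - A"] A E by (simp add: Un_absorb1)
      moreover have "ennreal (- \<nu> (E - A)) \<le> emeasure (upper_variation M (\<lambda>A. - \<nu> A)) E"
        using A E by (subst emeasure_upper_variation[OF \<nu>' E]) (intro upper_variation_fun_upper, auto)
      then have "- \<nu> (E - A) \<le> measure (upper_variation M (\<lambda>A. - \<nu> A)) E"
        by (simp add: N'.emeasure_eq_measure)
      ultimately show ?thesis by simp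
    qed
    then have "ennreal (measure (upper_variation M \<nu>) E) \<le> ennreal (measure (upper_variation M (\<lambda>A. - \<nu> A)) E + \<nu> E)"
      unfolding N.emeasure_eq_measure[symmetric] emeasure_upper_variation[OF \<nu> E] upper_variation_fun_def
      by (intro SUP_least ennreal_leI) auto
    moreover have "0 \<le> measure (upper_variation M (\<lambda>A. - \<nu> A)) E + \<nu> E"
      using \<open>\<And>A. A \<in> sets M \<Longrightarrow> A \<subseteq> E \<Longrightarrow> _\<close>[of "{}"] signed_measure_empty[OF \<nu>] by simp
    ultimately show ?thesis by simp
  qed
  show ?thesis
    using le[OF \<mu>] le[OF signed_measure_uminus[OF \<mu>]] by simp
qed

section \<open>Integrals against differences of finite measures\<close>

text \<open>
  Sums serve to turn identities between differences of measures into identities between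
  positive measures.
\<close>
definition measure_sum :: "'a measure \<Rightarrow> 'a measure \<Rightarrow> 'a measure" where
  "measure_sum M N = measure_of (space M) (sets M) (\<lambda>A. emeasure M A + emeasure N A)"

lemma sets_measure_sum[simp, measurable_cong]: "sets (measure_sum M N) = sets M"
  and space_measure_sum[simp]: "space (measure_sum M N) = space M"
  by (simp_all add: measure_sum_def)

lemma emeasure_measure_sum:
  assumes "sets N = sets M"
  shows "emeasure (measure_sum M N) A = emeasure M A + emeasure N A"
proof (cases "A \<in> sets M")
  case True
  have "countably_additive (sets M) (\<lambda>A. emeasure M A + emeasure N A)"
    using assms by (intro countably_additiveI) (simp add: suminf_add[symmetric] suminf_emeasure)
  with True show ?thesis
    unfolding measure_sum_def
    by (intro emeasure_measure_of_sigma) (auto simp: positive_def sets.sigma_algebra_axioms)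
qed (use assms in \<open>simp add: emeasure_notin_sets\<close>)

lemma finite_measure_measure_sum:
  assumes "sets N = sets M" "finite_measure M" "finite_measure N"
  shows "finite_measure (measure_sum M N)"
proof
  show "emeasure (measure_sum M N) (space (measure_sum M N)) \<noteq> \<infinity>"
    using assms finite_measure.emeasure_finite[of M] finite_measure.emeasure_finite[of N]
    by (simp add: emeasure_measure_sum)
qed

lemma nn_integral_measure_sum:
  assumes N: "sets N = sets M" and f: "f \<in> borel_measurable M"
  shows "(\<integral>\<^sup>+x. f x \<partial>measure_sum M N) = (\<integral>\<^sup>+x. f x \<partial>M) + (\<integral>\<^sup>+x. f x \<partial>N)"
  using f
proof (induction rule: borel_measurable_induct)
  case (cong f g)
  have "space N = space M" using N by (rule sets_eq_imp_space_eq)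
  with cong show ?case by (simp cong: nn_integral_cong_simp)
next
  case (set A)
  then show ?case using N by (simp add: emeasure_measure_sum)
next
  case (mult u c)
  then have "u \<in> borel_measurable N" using N by (simp cong: measurable_cong_sets)
  with mult show ?case by (simp add: nn_integral_cmult distrib_left cong: measurable_cong_sets)
next
  case (add u v)
  then have "u \<in> borel_measurable N" "v \<in> borel_measurable N" using N by (simp_all cong: measurable_cong_sets)
  with add show ?case by (simp add: nn_integral_add algebra_simps cong: measurable_cong_sets)
next
  case (seq U)
  then have U: "\<And>i. U i \<in> borel_measurable N" "\<And>i. U i \<in> borel_measurable (measure_sum M N)"
    using N by (simp_all cong: measurable_cong_sets)
  have inc: "incseq (\<lambda>i. integral\<^sup>N M (U i))" "incseq (\<lambda>i. integral\<^sup>N N (U i))"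
    using seq by (auto simp: incseq_def le_fun_def intro!: nn_integral_mono)
  have Sup: "Sup (range U) = (\<lambda>x. SUP i. U i x)"
    by (simp add: fun_eq_iff image_image)
  have lim: "integral\<^sup>N L (Sup (range U)) = (SUP i. integral\<^sup>N L (U i))" if "\<And>i. U i \<in> borel_measurable L" for L
    using nn_integral_monotone_convergence_SUP[OF seq(3) that] unfolding Sup by simp
  show ?case
    by (simp only: lim[OF seq(1)] lim[OF U(1)] lim[OF U(2)] seq.IH ennreal_SUP_add[OF inc])
qed

lemma integral_measure_sum:
  fixes f :: "'a \<Rightarrow> complex"
  assumes N: "sets N = sets M" and fM: "integrable M f" and fN: "integrable N f"
  shows "integral\<^sup>L (measure_sum M N) f = integral\<^sup>L M f + integral\<^sup>L N f"
proof -
  have re: "integrable (measure_sum M N) g \<and> integral\<^sup>L (measure_sum M N) g = integral\<^sup>L M g + integral\<^sup>L N g"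
    if M: "integrable M g" and N': "integrable N g" for g :: "'a \<Rightarrow> real"
  proof -
    have [measurable]: "g \<in> borel_measurable M" using M by simp
    have g: "g \<in> borel_measurable (measure_sum M N)" by simp
    have fin: "integral\<^sup>N M (\<lambda>x. ennreal (g x)) < \<infinity>" "integral\<^sup>N M (\<lambda>x. ennreal (- g x)) < \<infinity>"
       "integral\<^sup>N N (\<lambda>x. ennreal (g x)) < \<infinity>" "integral\<^sup>N N (\<lambda>x. ennreal (- g x)) < \<infinity>"
      using M N' by (auto simp: real_integrable_def less_top)
    have i: "integrable (measure_sum M N) g"
      using g fin by (auto simp: real_integrable_def nn_integral_measure_sum[OF N])
    show ?thesis
      using i M N' fin
      by (simp add: real_lebesgue_integral_def nn_integral_measure_sum[OF N] enn2real_plus)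
  qed
  note R = re[OF integrable_Re[OF fM] integrable_Re[OF fN]]
  note I = re[OF integrable_Im[OF fM] integrable_Im[OF fN]]
  have f: "integrable (measure_sum M N) f"
  proof -
    have "integrable (measure_sum M N) (\<lambda>x. complex_of_real (Re (f x)) + \<i> * complex_of_real (Im (f x)))"
      using R I by (intro Bochner_Integration.integrable_add integrable_mult_right integrable_of_real) auto
    then show ?thesis unfolding complex_eq[symmetric] .
  qed
  show ?thesis
    using R I integral_Re[OF f] integral_Re[OF fM] integral_Re[OF fN] integral_Im[OF f] integral_Im[OF fM] integral_Im[OF fN]
    by (intro complex_eqI) (simp_all only: plus_complex.simps)
qed

lemma integral_measure_sum_real:
  fixes f :: "'a \<Rightarrow> real"
  assumes N: "sets N = sets M" and fM: "integrable M f" and fN: "integrable N f"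
  shows "integral\<^sup>L (measure_sum M N) f = integral\<^sup>L M f + integral\<^sup>L N f"
proof -
  have "integral\<^sup>L (measure_sum M N) (\<lambda>x. complex_of_real (f x)) =
      integral\<^sup>L M (\<lambda>x. complex_of_real (f x)) + integral\<^sup>L N (\<lambda>x. complex_of_real (f x))"
    by (intro integral_measure_sum N integrable_of_real fM fN)
  then show ?thesis
    unfolding integral_complex_of_real by (simp only: of_real_add[symmetric] of_real_eq_iff)
qed

lemma signed_measure_diff:
  assumes P: "finite_measure P" "sets P = sets M" and N: "finite_measure N" "sets N = sets M"
  shows "signed_measure M (\<lambda>A. measure P A - measure N A)"
  unfolding signed_measure_def
  using assms by (auto intro!: sums_diff finite_measure.finite_measure_UNION)

text \<open>
  The integral against a signed measure may be computed from any representation as a difference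
  of finite measures, not only from the Jordan decomposition: if \<open>V - W = P - N\<close> then
  \<open>V + N = P + W\<close>, and integrals are additive in the measure.
\<close>
lemma signed_measure_integral_diff:
  assumes P: "finite_measure P" "sets P = sets M" and N: "finite_measure N" "sets N = sets M"
    and f: "f \<in> borel_measurable M" and bd: "\<And>x. norm (f x) \<le> B"
  shows "signed_measure_integral M (\<lambda>A. measure P A - measure N A) f = integral\<^sup>L P f - integral\<^sup>L N f"
proof -
  let ?\<mu> = "\<lambda>A. measure P A - measure N A"
  let ?V = "upper_variation M ?\<mu>" and ?W = "upper_variation M (\<lambda>A. - ?\<mu> A)"
  have s: "signed_measure M ?\<mu>" by (rule signed_measure_diff[OF P N])
  have V: "finite_measure ?V" and W: "finite_measure ?W"
    by (intro finite_measure_upper_variation signed_measure_uminus s)+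
  have int: "integrable Q f" if "finite_measure Q" "sets Q = sets M" for Q
    using that f bd by (intro finite_measure.integrable_const_bound[of _ _ B]) (auto cong: measurable_cong_sets)
  have "measure_sum ?V N = measure_sum P ?W"
  proof (rule measure_eqI)
    fix A assume "A \<in> sets (measure_sum ?V N)"
    then have A: "A \<in> sets M" by simp
    have "measure ?V A + measure N A = measure P A + measure ?W A"
      using jordan_decomposition[OF s A] by simp
    then show "emeasure (measure_sum ?V N) A = emeasure (measure_sum P ?W) A"
      using P N V W
      by (simp add: emeasure_measure_sum finite_measure.emeasure_eq_measure ennreal_plus[symmetric] del: ennreal_plus)
  qed (simp add: P)
  then have "integral\<^sup>L (measure_sum ?V N) f = integral\<^sup>L (measure_sum P ?W) f" by simp
  then have "integral\<^sup>L ?V f + integral\<^sup>L N f = integral\<^sup>L P f + integral\<^sup>L ?W f"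
    using P N V W by (simp add: integral_measure_sum int)
  then show ?thesis by (simp add: signed_measure_integral_def algebra_simps)
qed

lemma complex_measure_decomposition:
  assumes "complex_measure borel \<nu>"
  obtains P1 N1 P2 N2 :: "real measure" where
    "finite_measure P1" "finite_measure N1" "finite_measure P2" "finite_measure N2"
    "sets P1 = sets borel" "sets N1 = sets borel" "sets P2 = sets borel" "sets N2 = sets borel"
    "\<And>A. \<nu> A = of_real (measure P1 A - measure N1 A) + \<i> * of_real (measure P2 A - measure N2 A)"
    "\<And>f. complex_measure_integral borel \<nu> f =
       (integral\<^sup>L P1 f - integral\<^sup>L N1 f) + \<i> * (integral\<^sup>L P2 f - integral\<^sup>L N2 f)"
proof -
  have s1: "signed_measure borel (\<lambda>A. Re (\<nu> A))" and s2: "signed_measure borel (\<lambda>A. Im (\<nu> A))"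
    using assms by (auto simp: complex_measure_def signed_measure_def intro: sums_Re sums_Im)
  note s1' = signed_measure_uminus[OF s1] and s2' = signed_measure_uminus[OF s2]
  have eq: "\<nu> A = of_real (measure (upper_variation borel (\<lambda>A. Re (\<nu> A))) A - measure (upper_variation borel (\<lambda>A. - Re (\<nu> A))) A) +
     \<i> * of_real (measure (upper_variation borel (\<lambda>A. Im (\<nu> A))) A - measure (upper_variation borel (\<lambda>A. - Im (\<nu> A))) A)" for A
  proof (cases "A \<in> sets borel")
    case True
    then show ?thesis
      unfolding jordan_decomposition[OF s1 True, symmetric] jordan_decomposition[OF s2 True, symmetric]
      by (simp add: complex_eq[symmetric])
  next
    case False
    then show ?thesis using assms by (simp add: complex_measure_def measure_notin_sets)
  qed
  show ?thesis
    by (rule that[OF finite_measure_upper_variation[OF s1] finite_measure_upper_variation[OF s1']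
          finite_measure_upper_variation[OF s2] finite_measure_upper_variation[OF s2'] _ _ _ _ eq])
       (simp_all add: complex_measure_integral_def signed_measure_integral_def)
qed

text \<open>
  The converse of the preceding decomposition, for arbitrary finite measures. It is needed because
  the measures that come from four Herglotz functions have no reason to be mutually singular.
\<close>
lemma complex_measure_of_positive:
  fixes P1 N1 P2 N2 :: "real measure"
  assumes fin: "finite_measure P1" "finite_measure N1" "finite_measure P2" "finite_measure N2"
    and sets: "sets P1 = sets borel" "sets N1 = sets borel" "sets P2 = sets borel" "sets N2 = sets borel"
  defines "\<nu> \<equiv> \<lambda>A. of_real (measure P1 A - measure N1 A) + \<i> * of_real (measure P2 A - measure N2 A)"
  shows "complex_measure borel \<nu>"
    and "f \<in> borel_measurable borel \<Longrightarrow> (\<And>x. norm (f x) \<le> B) \<Longrightarrow> complex_measure_integral borel \<nu> f =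
       (integral\<^sup>L P1 f - integral\<^sup>L N1 f) + \<i> * (integral\<^sup>L P2 f - integral\<^sup>L N2 f)"
proof -
  have s: "signed_measure borel (\<lambda>A. measure P1 A - measure N1 A)" "signed_measure borel (\<lambda>A. measure P2 A - measure N2 A)"
    by (intro signed_measure_diff fin sets)+
  show "complex_measure borel \<nu>"
    unfolding complex_measure_def \<nu>_def
    using sets by (auto simp: measure_notin_sets intro!: sums_add sums_mult sums_of_real signed_measureD[OF s(1)] signed_measureD[OF s(2)]
       simp del: of_real_diff)
  assume f: "f \<in> borel_measurable borel" "\<And>x. norm (f x) \<le> B"
  have "(\<lambda>A. Re (\<nu> A)) = (\<lambda>A. measure P1 A - measure N1 A)" "(\<lambda>A. Im (\<nu> A)) = (\<lambda>A. measure P2 A - measure N2 A)"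
    by (simp_all add: \<nu>_def)
  then show "complex_measure_integral borel \<nu> f =
       (integral\<^sup>L P1 f - integral\<^sup>L N1 f) + \<i> * (integral\<^sup>L P2 f - integral\<^sup>L N2 f)"
    unfolding complex_measure_integral_def
    by (simp add: signed_measure_integral_diff[OF fin(1) sets(1) fin(2) sets(2) f] signed_measure_integral_diff[OF fin(3) sets(3) fin(4) sets(4) f])
qed

section \<open>The Herglotz kernel and the Cauchy transform of a finite measure\<close>

lemma Cauchy_kernel_bound:
  assumes "Im z \<noteq> 0"
  shows "of_real t - z \<noteq> 0" "norm (1 / (of_real t - z)) \<le> 1 / \<bar>Im z\<bar>"
proof -
  have le: "\<bar>Im z\<bar> \<le> norm (of_real t - z)"
    using abs_Im_le_cmod[of "of_real t - z"] by simp
  with assms show "of_real t - z \<noteq> 0" by auto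
  show "norm (1 / (of_real t - z)) \<le> 1 / \<bar>Im z\<bar>"
    using le assms unfolding norm_divide norm_one by (intro divide_left_mono mult_pos_pos) auto
qed

lemma Cauchy_kernel_measurable [measurable]:
  "(\<lambda>t. 1 / (of_real t - z)) \<in> borel_measurable borel" for z :: complex
  by measurable

lemma Im_Cauchy_kernel: "Im (1 / (of_real t - z)) = Im z / ((t - Re z)\<^sup>2 + (Im z)\<^sup>2)"
  by (simp add: Im_divide power2_eq_square)

text \<open>
  This splitting reduces most questions about the Herglotz kernel to the Cauchy kernel, which is bounded by
  \<open>1 / \<bar>Im z\<bar>\<close>.
\<close>
lemma Herglotz_kernel_eq:
  assumes "Im z \<noteq> 0"
  shows "(1 + of_real t * z) / (of_real t - z) = z + (1 + z\<^sup>2) * (1 / (of_real t - z))"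
  using Cauchy_kernel_bound(1)[OF assms, of t] by (simp add: field_simps power2_eq_square)

lemma Herglotz_kernel_bounded:
  assumes "Im z \<noteq> 0"
  shows "\<exists>B. \<forall>t. norm ((1 + of_real t * z) / (of_real t - z)) \<le> B"
proof (intro exI allI)
  fix t :: real
  have "norm ((1 + of_real t * z) / (of_real t - z)) \<le> norm z + norm ((1 + z\<^sup>2) * (1 / (of_real t - z)))"
    unfolding Herglotz_kernel_eq[OF assms] by (rule norm_triangle_ineq)
  also have "\<dots> \<le> norm z + norm (1 + z\<^sup>2) * (1 / \<bar>Im z\<bar>)"
    unfolding norm_mult by (intro add_left_mono mult_left_mono Cauchy_kernel_bound assms) simp
  finally show "norm ((1 + of_real t * z) / (of_real t - z)) \<le> norm z + norm (1 + z\<^sup>2) * (1 / \<bar>Im z\<bar>)" .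
qed

lemma cnj_integral_Cauchy_kernel:
  "cnj (\<integral>t. 1 / (of_real t - z) \<partial>\<mu>) = (\<integral>t. 1 / (of_real t - cnj z) \<partial>\<mu>)"
  using Bochner_Integration.integral_cnj[of \<mu> "\<lambda>t. 1 / (of_real t - z)"] by simp

lemma cnj_integral_Herglotz_kernel:
  "cnj (\<integral>t. (1 + of_real t * z) / (of_real t - z) \<partial>\<mu>) =
     (\<integral>t. (1 + of_real t * cnj z) / (of_real t - cnj z) \<partial>\<mu>)"
  using Bochner_Integration.integral_cnj[of \<mu> "\<lambda>t. (1 + of_real t * z) / (of_real t - z)"] by simp

context
  fixes \<mu> :: "real measure"
  assumes fin: "finite_measure \<mu>" and sets [measurable_cong]: "sets \<mu> = sets borel"
begin

interpretation finite_measure \<mu> by (rule fin)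

lemma integrable_Cauchy_kernel:
  assumes "Im z \<noteq> 0" shows "integrable \<mu> (\<lambda>t. 1 / (of_real t - z))"
  by (rule integrable_const_bound[of _ "1 / \<bar>Im z\<bar>"]) (use Cauchy_kernel_bound(2)[OF assms] in auto)

lemma integrable_Herglotz_kernel:
  assumes "Im z \<noteq> 0" shows "integrable \<mu> (\<lambda>t. (1 + of_real t * z) / (of_real t - z))"
  unfolding Herglotz_kernel_eq[OF assms]
  by (intro Bochner_Integration.integrable_add integrable_mult_right integrable_Cauchy_kernel assms) simp

lemma integral_Herglotz_kernel:
  assumes "Im z \<noteq> 0"
  shows "(\<integral>t. (1 + of_real t * z) / (of_real t - z) \<partial>\<mu>) =
           of_real (measure \<mu> UNIV) * z + (1 + z\<^sup>2) * (\<integral>t. 1 / (of_real t - z) \<partial>\<mu>)"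
proof -
  have space: "space \<mu> = UNIV" using sets_eq_imp_space_eq[OF sets] by simp
  have i: "integrable \<mu> (\<lambda>t. (1 + z\<^sup>2) * (1 / (of_real t - z)))"
    by (intro integrable_mult_right integrable_Cauchy_kernel assms)
  have "(\<integral>t. z + (1 + z\<^sup>2) * (1 / (of_real t - z)) \<partial>\<mu>) =
      (\<integral>t. z \<partial>\<mu>) + (\<integral>t. (1 + z\<^sup>2) * (1 / (of_real t - z)) \<partial>\<mu>)"
    by (rule Bochner_Integration.integral_add[OF _ i]) simp
  also have "(\<integral>t. (1 + z\<^sup>2) * (1 / (of_real t - z)) \<partial>\<mu>) = (1 + z\<^sup>2) * (\<integral>t. 1 / (of_real t - z) \<partial>\<mu>)"
    by (rule integral_mult_right_zero)
  finally show ?thesis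
    unfolding Herglotz_kernel_eq[OF assms] by (simp add: space scaleR_conv_of_real)
qed

text \<open>
  The Cauchy transform is differentiated under the integral sign. The difference quotient of the kernel deviates from its limit
  by \<open>(w - z) / ((t - z)\<^sup>2 (t - w))\<close>, which is bounded uniformly in \<open>t\<close> by a multiple of
  \<open>\<bar>w - z\<bar>\<close> as long as \<open>w\<close> stays away from the real axis.
\<close>
lemma Cauchy_transform_holomorphic:
  "(\<lambda>z. \<integral>t. 1 / (of_real t - z) \<partial>\<mu>) holomorphic_on - \<real>"
proof (rule holomorphic_onI)
  fix z :: complex assume "z \<in> - \<real>"
  then have z: "Im z \<noteq> 0" by (simp add: complex_is_Real_iff)
  define y where "y = \<bar>Im z\<bar>"
  have y: "y > 0" using z by (simp add: y_def)
  let ?C = "\<lambda>z. \<integral>t. 1 / (of_real t - z) \<partial>\<mu>"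
  let ?D = "\<integral>t. 1 / (of_real t - z) * (1 / (of_real t - z)) \<partial>\<mu>"
  have iD: "integrable \<mu> (\<lambda>t. 1 / (of_real t - z) * (1 / (of_real t - z)))"
    by (rule integrable_const_bound[of _ "1 / y * (1 / y)"])
       (use Cauchy_kernel_bound(2)[OF z] y in \<open>auto simp only: norm_mult y_def intro!: mult_mono AE_I2\<close>, auto)
  have bound: "norm ((?C w - ?C z) / (w - z) - ?D) \<le> norm (w - z) * (2 / y ^ 3 * measure \<mu> (space \<mu>))"
    if w: "w \<noteq> z" "dist w z < y / 2" for w
  proof -
    have "\<bar>Im w - Im z\<bar> < y / 2"
      using w abs_Im_le_cmod[of "w - z"] by (simp add: dist_norm)
    then have Imw1: "\<bar>Im w\<bar> \<ge> y / 2" unfolding y_def by linarith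
    with y have Imw: "\<bar>Im w\<bar> \<ge> y / 2" "Im w \<noteq> 0" by auto
    let ?g = "\<lambda>t. (w - z) * (1 / (of_real t - z) * (1 / (of_real t - z)) * (1 / (of_real t - w)))"
    have eq: "(1 / (of_real t - w) - 1 / (of_real t - z)) / (w - z) - 1 / (of_real t - z) * (1 / (of_real t - z)) = ?g t" for t :: real
      using Cauchy_kernel_bound(1)[OF z, of t] Cauchy_kernel_bound(1)[OF Imw(2), of t] w(1)
      by (simp add: divide_simps)
    note iw = integrable_Cauchy_kernel[OF Imw(2)] and iz = integrable_Cauchy_kernel[OF z]
    note iwz = Bochner_Integration.integrable_diff[OF iw iz]
    have "(?C w - ?C z) / (w - z) - ?D =
        (\<integral>t. (1 / (of_real t - w) - 1 / (of_real t - z)) / (w - z) \<partial>\<mu>) - ?D"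
      unfolding integral_divide_zero by (subst Bochner_Integration.integral_diff[OF iw iz]) (rule refl)
    also have "\<dots> = (\<integral>t. (1 / (of_real t - w) - 1 / (of_real t - z)) / (w - z)
        - 1 / (of_real t - z) * (1 / (of_real t - z)) \<partial>\<mu>)"
      by (rule Bochner_Integration.integral_diff[OF integrable_divide_zero iD, symmetric]) (rule impI iwz)+
    finally have "(?C w - ?C z) / (w - z) - ?D = (\<integral>t. ?g t \<partial>\<mu>)"
      unfolding eq .
    then have "norm ((?C w - ?C z) / (w - z) - ?D) = norm (\<integral>t. ?g t \<partial>\<mu>)" by (rule arg_cong)
    also have "\<dots> \<le> (\<integral>t. norm (w - z) * (2 / y ^ 3) \<partial>\<mu>)"
    proof (rule order_trans[OF Bochner_Integration.integral_norm_bound Bochner_Integration.integral_mono])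
      have g_le: "norm (?g t) \<le> norm (w - z) * (2 / y ^ 3)" for t :: real
      proof -
        have 1: "norm (1 / (of_real t - z)) \<le> 1 / y" using Cauchy_kernel_bound(2)[OF z] by (simp add: y_def)
        have "norm (1 / (of_real t - w)) \<le> 1 / \<bar>Im w\<bar>" by (rule Cauchy_kernel_bound(2)[OF Imw(2)])
        also have "\<dots> \<le> 1 / (y / 2)" using Imw y by (intro divide_left_mono) auto
        finally have 2: "norm (1 / (of_real t - w)) \<le> 1 / (y / 2)" .
        have "norm (?g t) \<le> norm (w - z) * (1 / y * (1 / y) * (1 / (y / 2)))"
          unfolding norm_mult using y by (intro mult_left_mono mult_mono 1 2) auto
        then show ?thesis by (simp add: power3_eq_cube field_simps)
      qed
      show "integrable \<mu> (\<lambda>t. norm (?g t))"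
        by (rule integrable_norm, rule integrable_const_bound[of _ "norm (w - z) * (2 / y ^ 3)"]) (use g_le in auto)
      show "integrable \<mu> (\<lambda>t. norm (w - z) * (2 / y ^ 3))" by simp
      show "norm (?g t) \<le> norm (w - z) * (2 / y ^ 3)" for t by (rule g_le)
    qed
    finally show ?thesis by (simp add: mult_ac)
  qed
  have "((\<lambda>w. (?C w - ?C z) / (w - z) - ?D) \<longlongrightarrow> 0) (at z)"
  proof (rule Lim_null_comparison)
    show "\<forall>\<^sub>F w in at z. norm ((?C w - ?C z) / (w - z) - ?D) \<le> norm (w - z) * (2 / y ^ 3 * measure \<mu> (space \<mu>))"
      unfolding eventually_at using y bound by (intro exI[of _ "y / 2"]) auto
    show "((\<lambda>w. norm (w - z) * (2 / y ^ 3 * measure \<mu> (space \<mu>))) \<longlongrightarrow> 0) (at z)"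
      using y by (auto intro!: tendsto_eq_intros)
  qed
  then have "(?C has_field_derivative ?D) (at z)"
    unfolding has_field_derivative_iff by (simp add: LIM_zero_iff)
  then show "?C field_differentiable at z within - \<real>"
    using field_differentiable_at_within field_differentiable_def by blast
qed

text \<open>
  Positivity is that of the Poisson-type density
  \<open>Im ((1 + t z) / (t - z)) = Im z (1 + t\<^sup>2) / \<bar>t - z\<bar>\<^sup>2\<close>.
\<close>
lemma herglotz_of_representation:
  fixes a b :: real
  assumes b: "b \<ge> 0"
  shows "herglotz (\<lambda>z. of_real a + of_real b * z + 1 / of_real pi * (\<integral>t. (1 + of_real t * z) / (of_real t - z) \<partial>\<mu>))"
    (is "herglotz ?h")
proof -
  have h: "?h z = of_real a + of_real b * z + 1 / of_real pi *
      (of_real (measure \<mu> UNIV) * z + (1 + z\<^sup>2) * (\<integral>t. 1 / (of_real t - z) \<partial>\<mu>))" if "z \<in> - \<real>" for z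
    using integral_Herglotz_kernel[of z] that by (simp add: complex_is_Real_iff)
  have "?h holomorphic_on - \<real>"
    by (rule iffD2[OF holomorphic_cong[OF refl h]]) (auto intro!: holomorphic_intros Cauchy_transform_holomorphic)
  moreover have "0 \<le> Im (?h z) / Im z \<and> cnj (?h z) = ?h (cnj z)" if "z \<in> - \<real>" for z
  proof
    have z: "Im z \<noteq> 0" using that by (simp add: complex_is_Real_iff)
    have Im: "Im ((1 + of_real t * z) / (of_real t - z)) = Im z * ((1 + t\<^sup>2) / ((t - Re z)\<^sup>2 + (Im z)\<^sup>2))" for t
      by (simp add: Im_divide power2_eq_square algebra_simps)
    have "Im (\<integral>t. (1 + of_real t * z) / (of_real t - z) \<partial>\<mu>) =
        (\<integral>t. Im z * ((1 + t\<^sup>2) / ((t - Re z)\<^sup>2 + (Im z)\<^sup>2)) \<partial>\<mu>)"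
      using integral_Im[OF integrable_Herglotz_kernel[OF z]] unfolding Im by simp
    also have "\<dots> = Im z * (\<integral>t. (1 + t\<^sup>2) / ((t - Re z)\<^sup>2 + (Im z)\<^sup>2) \<partial>\<mu>)"
      by (rule integral_mult_right_zero)
    finally have "Im (?h z) / Im z = b + (\<integral>t. (1 + t\<^sup>2) / ((t - Re z)\<^sup>2 + (Im z)\<^sup>2) \<partial>\<mu>) / pi"
      using z by (simp add: Im_divide_of_real field_simps)
    moreover have "0 \<le> (\<integral>t. (1 + t\<^sup>2) / ((t - Re z)\<^sup>2 + (Im z)\<^sup>2) \<partial>\<mu>)"
      by (intro integral_nonneg_AE AE_I2) auto
    ultimately show "0 \<le> Im (?h z) / Im z" using b by simp
    show "cnj (?h z) = ?h (cnj z)"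
      by (simp add: cnj_integral_Herglotz_kernel)
  qed
  ultimately show ?thesis by (simp add: herglotz_def)
qed

end

section \<open>The Riesz-Herglotz theorem in the unit disc\<close>

text \<open>
  The parameter runs over the whole real line and not only over \<open>{0..1}\<close>: limits of measures can
  then be taken on the line, and wherever their mass ends up the integrand has the right value.
\<close>
abbreviation circ :: "real \<Rightarrow> complex" where "circ s \<equiv> cis (2 * pi * s)"

lemma circ_neq: "norm w < 1 \<Longrightarrow> circ s - w \<noteq> 0"
  using norm_cis[of "2 * pi * s"] by auto

text \<open>
  On the unit circle the conjugate is the inverse. Thus the Schwarz kernel agrees there
  with the conjugate of a function that is holomorphic in \<open>z\<close> on the closed disc.
\<close>
lemma cnj_Schwarz_kernel:
  assumes z: "norm z = 1"
  shows "cnj ((1 + cnj w * z) / (1 - cnj w * z)) = (z + w) / (z - w)"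
proof -
  have "z * cnj z = 1" and "z \<noteq> 0" using z by (auto simp: complex_norm_square[symmetric])
  have "cnj ((1 + cnj w * z) / (1 - cnj w * z)) = (z * (1 + w * cnj z)) / (z * (1 - w * cnj z))"
    using \<open>z \<noteq> 0\<close> by simp
  also have "z * (1 + w * cnj z) = z + w * (z * cnj z)" by (simp add: algebra_simps)
  also have "z * (1 - w * cnj z) = z - w * (z * cnj z)" by (simp add: algebra_simps)
  finally show ?thesis unfolding \<open>z * cnj z = 1\<close> by simp
qed

lemma Cauchy_formula_unit_circle:
  assumes f: "f holomorphic_on cball 0 1" and w: "norm w < 1"
  shows "((\<lambda>s. f (circ s) * (circ s / (circ s - w))) has_integral f w) {0..1}"
proof -
  have "((\<lambda>u. f u / (u - w)) has_contour_integral (2 * of_real pi * \<i> * f w)) (circlepath 0 1)"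
    using assms by (intro Cauchy_integral_circlepath_simple) auto
  then have "((\<lambda>s. f (circlepath 0 1 s) / (circlepath 0 1 s - w) *
       vector_derivative (circlepath 0 1) (at s within {0..1})) has_integral (2 * of_real pi * \<i> * f w)) {0..1}"
    by (simp add: has_contour_integral_def)
  then have "((\<lambda>s. f (circ s) / (circ s - w) * (2 * of_real pi * \<i> * circ s)) has_integral (2 * of_real pi * \<i> * f w)) {0..1}"
  proof (rule has_integral_eq[rotated])
    fix s :: real assume s: "s \<in> {0..1}"
    have "circlepath 0 1 s = circ s" by (simp add: circlepath cis_conv_exp mult_ac)
    moreover have "vector_derivative (circlepath 0 1) (at s within {0..1}) = 2 * of_real pi * \<i> * circ s"
      using s by (simp add: vector_derivative_circlepath01 cis_conv_exp mult_ac)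
    ultimately show "f (circlepath 0 1 s) / (circlepath 0 1 s - w) * vector_derivative (circlepath 0 1) (at s within {0..1}) =
        f (circ s) / (circ s - w) * (2 * of_real pi * \<i> * circ s)" by simp
  qed
  from has_integral_mult_right[OF this, of "1 / (2 * of_real pi * \<i>)"]
  show ?thesis by (simp add: field_simps)
qed

lemma mean_value_unit_circle:
  assumes "f holomorphic_on cball 0 1"
  shows "((\<lambda>s. f (circ s)) has_integral f 0) {0..1}"
  using Cauchy_formula_unit_circle[OF assms, of 0] by simp

text \<open>
  Write \<open>Re f\<close> as half the sum of \<open>f\<close> and its conjugate. Since \<open>(\<zeta> + w) / (\<zeta> - w) = 2 \<zeta> / (\<zeta> - w) - 1\<close>,
  the Cauchy formula and the mean value property evaluate the first half to \<open>2 f(w) - f(0)\<close>. The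
  second half is the conjugate of a mean value of a holomorphic function, by
  \<open>cnj_Schwarz_kernel\<close>, and contributes the conjugate of \<open>f(0)\<close>.
\<close>
lemma Schwarz_formula_unit_circle:
  assumes f: "f holomorphic_on cball 0 1" and w: "norm w < 1"
  shows "((\<lambda>s. of_real (Re (f (circ s))) * ((circ s + w) / (circ s - w)))
            has_integral (f w - \<i> * Im (f 0))) {0..1}"
proof -
  define g where "g \<zeta> = f \<zeta> * ((1 + cnj w * \<zeta>) / (1 - cnj w * \<zeta>))" for \<zeta>
  have ne: "circ s - w \<noteq> 0" for s
    by (rule circ_neq[OF w])
  have ne': "1 - cnj w * \<zeta> \<noteq> 0" if "\<zeta> \<in> cball 0 1" for \<zeta>
  proof
    assume "1 - cnj w * \<zeta> = 0"
    then have "cnj w * \<zeta> = 1" by simp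
    then have "norm (cnj w * \<zeta>) = 1" by (metis norm_one)
    moreover have "norm (cnj w) * norm \<zeta> \<le> norm w * 1"
      using that by (intro mult_mono) auto
    ultimately show False using w by (simp add: norm_mult)
  qed
  have "g holomorphic_on cball 0 1"
    unfolding g_def using ne' by (intro holomorphic_intros f) auto
  then have "((\<lambda>s. g (circ s)) has_integral g 0) {0..1}"
    by (rule mean_value_unit_circle)
  then have 1: "((\<lambda>s. cnj (g (circ s))) has_integral cnj (f 0)) {0..1}"
    by (subst has_integral_cnj[symmetric]) (simp add: o_def g_def)
  have 2: "((\<lambda>s. 2 * (f (circ s) * (circ s / (circ s - w))) - f (circ s)) has_integral (2 * f w - f 0)) {0..1}"
    by (intro has_integral_diff has_integral_mult_right Cauchy_formula_unit_circle mean_value_unit_circle f w)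
  have "((\<lambda>s. (1/2) * ((2 * (f (circ s) * (circ s / (circ s - w))) - f (circ s)) + cnj (g (circ s))))
      has_integral (1/2) * ((2 * f w - f 0) + cnj (f 0))) {0..1}"
    by (intro has_integral_mult_right has_integral_add 1 2)
  moreover have "(1/2) * ((2 * f w - f 0) + cnj (f 0)) = f w - \<i> * Im (f 0)"
    by (simp add: complex_eq_iff)
  moreover have "(1/2) * ((2 * (f (circ s) * (circ s / (circ s - w))) - f (circ s)) + cnj (g (circ s)))
      = of_real (Re (f (circ s))) * ((circ s + w) / (circ s - w))" for s
  proof -
    have g: "cnj (g (circ s)) = cnj (f (circ s)) * ((circ s + w) / (circ s - w))"
      unfolding g_def complex_cnj_mult by (subst cnj_Schwarz_kernel) simp_all
    have *: "(circ s + w) / (circ s - w) = 2 * (circ s / (circ s - w)) - 1"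
    proof -
      have "(circ s + w) / (circ s - w) = (2 * circ s - (circ s - w)) / (circ s - w)" by simp
      also have "\<dots> = 2 * circ s / (circ s - w) - (circ s - w) / (circ s - w)" by (rule diff_divide_distrib)
      also have "\<dots> = 2 * (circ s / (circ s - w)) - 1" using ne by simp
      finally show ?thesis .
    qed
    have "2 * (f (circ s) * (circ s / (circ s - w))) - f (circ s) = f (circ s) * ((circ s + w) / (circ s - w))"
      unfolding * by (simp add: right_diff_distrib)
    moreover have "of_real (Re (f (circ s))) = (1/2) * (f (circ s) + cnj (f (circ s)))"
      by (simp add: complex_eq_iff)
    ultimately show ?thesis unfolding g by (simp only: ring_distribs mult.assoc)
  qed
  ultimately show ?thesis by (simp only:)
qed

lemma continuous_Schwarz_kernel:
  assumes "norm w < 1"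
  shows "continuous_on A (\<lambda>s. (circ s + w) / (circ s - w))"
    and "norm ((circ s + w) / (circ s - w)) \<le> 2 / (1 - norm w)"
proof -
  have ne: "circ s - w \<noteq> 0" for s
    by (rule circ_neq[OF assms])
  show "continuous_on A (\<lambda>s. (circ s + w) / (circ s - w))"
    using ne by (intro continuous_intros) auto
  have "norm (circ s + w) \<le> 2"
    using norm_triangle_ineq[of "circ s" w] assms by simp
  moreover have "norm (circ s - w) \<ge> 1 - norm w"
    using norm_triangle_ineq2[of "circ s" w] by simp
  ultimately show "norm ((circ s + w) / (circ s - w)) \<le> 2 / (1 - norm w)"
    unfolding norm_divide using assms by (intro frac_le) auto
qed

text \<open>
  The measures with density \<open>Re (F (r e)) / Re (F 0)\<close> on one period are probability measures, and
  all of them live on \<open>{0..1}\<close>, so that they are tight. If \<open>Re (F 0) = 0\<close> this normalisation is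
  impossible, but then a nonnegative continuous density with integral \<open>0\<close> vanishes, and \<open>F\<close> is
  constant.
\<close>
lemma Riesz_Herglotz_disc:
  assumes F: "F holomorphic_on ball 0 1" and Re: "\<And>w. norm w < 1 \<Longrightarrow> 0 \<le> Re (F w)"
  obtains M :: "real measure" where "sets M = sets borel" "finite_measure M"
    "\<And>w. norm w < 1 \<Longrightarrow> F w = \<i> * Im (F 0) + (\<integral>s. (circ s + w) / (circ s - w) \<partial>M)"
proof -
  \<comment> \<open>The shift by \<open>2\<close> keeps the radii strictly between \<open>0\<close> and \<open>1\<close>, also for \<open>n = 0\<close>.\<close>
  define r where "r n = 1 - 1 / (real n + 2)" for n
  have r: "0 < r n" "r n < 1" for n by (auto simp: r_def)
  have r_lim: "r \<longlonglongrightarrow> 1" unfolding r_def by real_asymp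
  define u where "u n s = Re (F (of_real (r n) * circ s))" for n s
  have in_ball: "norm (of_real (r n) * w) < 1" if "norm w \<le> 1" for n and w :: complex
  proof -
    have "norm (of_real (r n) * w) \<le> r n * 1"
      using that r[of n] unfolding norm_mult by (intro mult_mono) auto
    then show ?thesis using r[of n] by simp
  qed
  have hol: "(\<lambda>w. F (of_real (r n) * w)) holomorphic_on cball 0 1" for n
    by (rule holomorphic_on_compose_gen[of "\<lambda>w. of_real (r n) * w" _ F "ball 0 1", unfolded o_def])
       (use in_ball in \<open>auto intro!: holomorphic_intros F\<close>)
  have u_nonneg: "0 \<le> u n s" for n s
    unfolding u_def by (intro Re in_ball) simp
  have u_cont: "continuous_on A (u n)" for A n
    unfolding u_def
    by (intro continuous_intros continuous_on_compose2[OF holomorphic_on_imp_continuous_on[OF F]])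
       (auto simp: in_ball)
  have schwarz: "((\<lambda>s. of_real (u n s) * ((circ s + w) / (circ s - w)))
      has_integral (F (of_real (r n) * w) - \<i> * Im (F 0))) {0..1}" if "norm w < 1" for n w
    using Schwarz_formula_unit_circle[OF hol that, of n] by (simp add: u_def)
  define c where "c = Re (F 0)"
  have mass: "(u n has_integral c) {0..1}" for n
  proof -
    have "((\<lambda>s. of_real (u n s) * ((circ s + 0) / (circ s - 0))) has_integral (F (of_real (r n) * 0) - \<i> * Im (F 0))) {0..1}"
      by (rule schwarz) simp
    then have "((\<lambda>s. Re (of_real (u n s))) has_integral Re (F 0 - \<i> * Im (F 0))) {0..1}"
      by (intro has_integral_Re) simp
    then show ?thesis by (simp add: c_def)
  qed
  have lim_w: "(\<lambda>n. F (of_real (r (k n)) * w)) \<longlonglongrightarrow> F w" if "norm w < 1" "strict_mono k" for w k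
  proof -
    have "(\<lambda>n. of_real (r (k n)) * w) \<longlonglongrightarrow> of_real 1 * w"
      using LIMSEQ_subseq_LIMSEQ[OF r_lim that(2)] by (intro tendsto_intros) (simp add: o_def)
    moreover have "isCont F w"
      using F that(1) by (intro continuous_on_interior[OF holomorphic_on_imp_continuous_on[OF F]]) simp
    ultimately show ?thesis
      using isCont_tendsto_compose[of w F "\<lambda>n. of_real (r (k n)) * w"] by simp
  qed
  show ?thesis
  proof (cases "c = 0")
    case True
    have "u n s = 0" if "s \<in> {0..1}" for n s
      using integral_eq_0_iff[of 0 1 "u n"] u_cont u_nonneg mass[of n] that True
      by (auto simp: integral_unique)
    then have "((\<lambda>s. 0) has_integral (F (of_real (r n) * w) - \<i> * Im (F 0))) {0..1}" if "norm w < 1" for n w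
      using has_integral_eq[OF _ schwarz[OF that, of n], of "\<lambda>s. 0"] by simp
    from has_integral_unique[OF this has_integral_0]
    have *: "F (of_real (r n) * w) = \<i> * Im (F 0)" if "norm w < 1" for n w
      using that by fastforce
    have "F w = \<i> * Im (F 0)" if "norm w < 1" for w
      using lim_w[OF that strict_mono_id] *[OF that] by (simp add: LIMSEQ_const_iff)
    moreover have "finite_measure (null_measure borel :: real measure)"
      by (rule finite_measureI) simp
    ultimately show ?thesis
      by (intro that[of "null_measure borel"]) (simp_all only: sets_null_measure integral_null_measure add_0_right)
  next
    case False
    then have c: "c > 0" using Re[of 0] by (simp add: c_def)
    define \<mu> where "\<mu> n = density lborel (\<lambda>s. ennreal (indicator {0..1} s * (u n s / c)))" for n
    have [measurable]: "u n \<in> borel_measurable borel" for n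
      by (intro borel_measurable_continuous_onI u_cont)
    have sets_\<mu> [simp]: "sets (\<mu> n) = sets borel" for n by (simp add: \<mu>_def)
    have nn: "(\<integral>\<^sup>+s. ennreal (indicator {0..1} s * (u n s / c)) \<partial>lborel) = 1" for n
    proof -
      have "((\<lambda>s. u n s * (1 / c)) has_integral c * (1 / c)) {0..1}"
        by (intro has_integral_mult_left mass)
      then have "((\<lambda>s. if s \<in> {0..1} then u n s * (1 / c) else 0) has_integral c * (1 / c)) UNIV"
        by (simp only: has_integral_restrict_UNIV)
      moreover have "(\<lambda>s. if s \<in> {0..1} then u n s * (1 / c) else 0) = (\<lambda>s. indicator {0..1} s * (u n s / c))"
        by (auto simp: fun_eq_iff)
      moreover have "c * (1 / c) = 1" using c by simp
      ultimately have "((\<lambda>s. indicator {0..1} s * (u n s / c)) has_integral 1) UNIV"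
        by (simp only:)
      moreover have "(\<lambda>s. indicator {0..1} s * (u n s / c)) \<in> borel_measurable borel" by measurable
      moreover have "0 \<le> indicator {0..1} s * (u n s / c)" for s using c u_nonneg[of n s] by simp
      ultimately show ?thesis
        using nn_integral_has_integral_lborel[of "\<lambda>s. indicator {0..1} s * (u n s / c)" 1]
        unfolding ennreal_1 by blast
    qed
    have full: "emeasure (\<mu> n) A = 1" if A: "A \<in> sets borel" "{0..1} \<subseteq> A" for A n
    proof -
      have "emeasure (\<mu> n) A = (\<integral>\<^sup>+s. ennreal (indicator {0..1} s * (u n s / c)) * indicator A s \<partial>lborel)"
        unfolding \<mu>_def using A by (intro emeasure_density) auto
      also have "\<dots> = (\<integral>\<^sup>+s. ennreal (indicator {0..1} s * (u n s / c)) \<partial>lborel)"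
        using A by (intro nn_integral_cong) (auto simp: indicator_def)
      finally show ?thesis unfolding nn .
    qed
    have real_dist: "real_distribution (\<mu> n)" for n
      unfolding real_distribution_def real_distribution_axioms_def
      using full[of UNIV n] sets_eq_imp_space_eq[OF sets_\<mu>[of n]] by (auto intro!: prob_spaceI)
    have "tight \<mu>"
      unfolding tight_def
    proof (intro conjI allI impI real_dist)
      fix \<epsilon> :: real assume "\<epsilon> > 0"
      have "{0..1::real} \<subseteq> {-1<..1}" by auto
      then have "emeasure (\<mu> n) {-1<..1} = 1" for n
        by (intro full) auto
      then show "\<exists>a b. a < b \<and> (\<forall>n. 1 - \<epsilon> < measure (\<mu> n) {a<..b})"
        using \<open>\<epsilon> > 0\<close> by (intro exI[of _ "-1"] exI[of _ 1]) (simp add: measure_def)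
    qed
    from tight_imp_convergent_subsubsequence[OF this strict_mono_id]
    obtain k M where k: "strict_mono (k :: nat \<Rightarrow> nat)" and M: "real_distribution M"
      and conv: "weak_conv_m (\<mu> \<circ> k) M" by auto
    interpret M: real_distribution M by fact
    have int_\<mu>: "c *\<^sub>R (\<integral>s. (circ s + w) / (circ s - w) \<partial>\<mu> n) = F (of_real (r n) * w) - \<i> * Im (F 0)"
      if w: "norm w < 1" for n w
    proof -
      have [measurable]: "(\<lambda>s. (circ s + w) / (circ s - w)) \<in> borel_measurable borel"
        by (intro borel_measurable_continuous_onI continuous_Schwarz_kernel w)
      have "c *\<^sub>R (\<integral>s. (circ s + w) / (circ s - w) \<partial>\<mu> n) =
          c *\<^sub>R (\<integral>s. (indicator {0..1} s * (u n s / c)) *\<^sub>R ((circ s + w) / (circ s - w)) \<partial>lborel)"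
        unfolding \<mu>_def using c u_nonneg by (subst integral_density) auto
      also have "\<dots> = (\<integral>s. c *\<^sub>R ((indicator {0..1} s * (u n s / c)) *\<^sub>R ((circ s + w) / (circ s - w))) \<partial>lborel)"
        by (rule Bochner_Integration.integral_scaleR_right[symmetric])
      also have "\<dots> = (LINT s:{0..1}|lborel. of_real (u n s) * ((circ s + w) / (circ s - w)))"
        unfolding set_lebesgue_integral_def using c
        by (intro Bochner_Integration.integral_cong) (auto simp: indicator_def scaleR_conv_of_real)
      also have "\<dots> = integral {0..1} (\<lambda>s. of_real (u n s) * ((circ s + w) / (circ s - w)))"
        by (intro set_borel_integral_eq_integral borel_integrable_atLeastAtMost' continuous_intros
              continuous_on_of_real u_cont continuous_Schwarz_kernel w)
      also have "\<dots> = F (of_real (r n) * w) - \<i> * Im (F 0)"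
        by (rule integral_unique[OF schwarz[OF w]])
      finally show ?thesis .
    qed
    define M' where "M' = density M (\<lambda>_. ennreal c)"
    have "F w = \<i> * Im (F 0) + (\<integral>s. (circ s + w) / (circ s - w) \<partial>M')" if w: "norm w < 1" for w
    proof -
      have ker [measurable]: "(\<lambda>s. (circ s + w) / (circ s - w)) \<in> borel_measurable borel"
        by (intro borel_measurable_continuous_onI continuous_Schwarz_kernel w)
      have "(\<lambda>n. \<integral>s. (circ s + w) / (circ s - w) \<partial>(\<mu> \<circ> k) n) \<longlonglongrightarrow> (\<integral>s. (circ s + w) / (circ s - w) \<partial>M)"
        using continuous_Schwarz_kernel(1)[OF w, of UNIV]
        by (intro weak_conv_imp_integral_bdd_continuous_conv[OF _ M conv, of _ "2 / (1 - norm w)"]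
              continuous_Schwarz_kernel(2)[OF w])
           (auto simp: real_dist continuous_on_eq_continuous_at)
      then have "(\<lambda>n. c *\<^sub>R (\<integral>s. (circ s + w) / (circ s - w) \<partial>\<mu> (k n))) \<longlonglongrightarrow> c *\<^sub>R (\<integral>s. (circ s + w) / (circ s - w) \<partial>M)"
        by (intro tendsto_intros) (simp add: o_def)
      moreover have "(\<lambda>n. c *\<^sub>R (\<integral>s. (circ s + w) / (circ s - w) \<partial>\<mu> (k n))) \<longlonglongrightarrow> F w - \<i> * Im (F 0)"
        unfolding int_\<mu>[OF w] by (intro tendsto_intros lim_w w k)
      ultimately have "F w - \<i> * Im (F 0) = c *\<^sub>R (\<integral>s. (circ s + w) / (circ s - w) \<partial>M)"
        using LIMSEQ_unique by blast
      also have "\<dots> = (\<integral>s. (circ s + w) / (circ s - w) \<partial>M')"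
        unfolding M'_def using c by (subst integral_density) (auto simp: measurable_cong_sets[OF M.events_eq_borel refl] ker)
      finally show ?thesis by (simp add: algebra_simps)
    qed
    moreover have "finite_measure M'"
    proof (rule finite_measureI)
      have "emeasure M' (space M') = ennreal c * emeasure M (space M)"
        unfolding M'_def space_density by (rule emeasure_density_const) simp
      then show "emeasure M' (space M') \<noteq> \<infinity>" by (simp only: M.emeasure_space_1) simp
    qed
    moreover have "sets M' = sets borel" unfolding M'_def by simp
    ultimately show ?thesis using that by blast
  qed
qed

section \<open>Transfer to the half-plane: Herglotz functions\<close>

lemma Cayley_in_disc:
  assumes "Im z > 0"
  shows "norm ((z - \<i>) / (z + \<i>)) < 1" "\<i> * (1 + (z - \<i>) / (z + \<i>)) / (1 - (z - \<i>) / (z + \<i>)) = z" "z + \<i> \<noteq> 0"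
proof -
  show ne: "z + \<i> \<noteq> 0" using assms by (auto simp: complex_eq_iff)
  have "(norm (z - \<i>))\<^sup>2 < (norm (z + \<i>))\<^sup>2"
    using assms unfolding cmod_power2 by (simp add: power2_eq_square algebra_simps)
  then have "norm (z - \<i>) < norm (z + \<i>)" by (rule power_less_imp_less_base) simp
  then show "norm ((z - \<i>) / (z + \<i>)) < 1" using ne by (simp add: norm_divide)
  have e: "1 + (z - \<i>) / (z + \<i>) = 2 * z / (z + \<i>)" "1 - (z - \<i>) / (z + \<i>) = 2 * \<i> / (z + \<i>)"
    using ne by (simp_all add: field_simps)
  show "\<i> * (1 + (z - \<i>) / (z + \<i>)) / (1 - (z - \<i>) / (z + \<i>)) = z"
    unfolding e using ne by simp
qed

lemma Im_inverse_Cayley_pos: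
  assumes "norm w < 1"
  shows "1 - w \<noteq> 0" "Im (\<i> * (1 + w) / (1 - w)) > 0"
proof -
  show ne: "1 - w \<noteq> 0" using assms by auto
  have "Im (\<i> * (1 + w) / (1 - w)) = (1 - (norm w)\<^sup>2) / (norm (1 - w))\<^sup>2"
    unfolding cmod_power2 by (simp add: Im_divide power2_eq_square algebra_simps)
  moreover have "(norm w)\<^sup>2 < 1" using assms by (simp add: abs_square_less_1)
  ultimately show "Im (\<i> * (1 + w) / (1 - w)) > 0" using ne by simp
qed

text \<open>
  The map \<open>s \<mapsto> - cot (\<pi> s)\<close> is the composition of \<^const>\<open>cis\<close> at \<open>2 \<pi> s\<close> with the inverse Cayley
  transform; the integers \<open>s\<close> are mapped to the point \<open>1\<close> of the circle, which corresponds to infinity.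
\<close>
lemma Schwarz_kernel_Cayley:
  assumes z: "Im z > 0"
  shows "\<i> * ((circ s + (z - \<i>) / (z + \<i>)) / (circ s - (z - \<i>) / (z + \<i>))) =
    (if sin (pi * s) = 0 then z else (1 + of_real (- cot (pi * s)) * z) / (of_real (- cot (pi * s)) - z))"
proof -
  note ne = Cayley_in_disc(3)[OF z]
  define C S where "C = complex_of_real (cos (pi * s))" and "S = complex_of_real (sin (pi * s))"
  have CS: "C * C + S * S = 1"
  proof -
    have "C * C + S * S = of_real (cos (pi * s) * cos (pi * s) + sin (pi * s) * sin (pi * s))"
      unfolding C_def S_def by (simp only: of_real_mult of_real_add)
    then show ?thesis by (simp only: sin_cos_squared_add3 of_real_1)
  qed
  have circ: "circ s = (C + \<i> * S) * (C + \<i> * S)"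
  proof -
    have "circ s = cis (pi * s) * cis (pi * s)" by (simp add: cis_mult mult.assoc)
    moreover have "cis (pi * s) = C + \<i> * S" by (simp add: C_def S_def complex_eq_iff)
    ultimately show ?thesis by (simp only:)
  qed
  have ne2: "circ s - (z - \<i>) / (z + \<i>) \<noteq> 0"
    by (rule circ_neq[OF Cayley_in_disc(1)[OF z]])
  have "(circ s + (z - \<i>) / (z + \<i>)) / (circ s - (z - \<i>) / (z + \<i>)) =
      (circ s * (z + \<i>) + (z - \<i>)) / (circ s * (z + \<i>) - (z - \<i>))"
  proof -
    have "circ s + (z - \<i>) / (z + \<i>) = (circ s * (z + \<i>) + (z - \<i>)) / (z + \<i>)"
      "circ s - (z - \<i>) / (z + \<i>) = (circ s * (z + \<i>) - (z - \<i>)) / (z + \<i>)"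
      using ne by (simp_all add: add_divide_distrib diff_divide_distrib)
    then show ?thesis using ne by simp
  qed
  also have "circ s * (z + \<i>) + (z - \<i>) = 2 * (C + \<i> * S) * (C * z - S)"
  proof -
    have "circ s * (z + \<i>) + (z - \<i>) = (C + \<i> * S) * (C + \<i> * S) * (z + \<i>) + (C * C + S * S) * (z - \<i>)"
      unfolding circ CS by simp
    also have "\<dots> = 2 * (C + \<i> * S) * (C * z - S)" by (simp add: algebra_simps)
    finally show ?thesis .
  qed
  also have "circ s * (z + \<i>) - (z - \<i>) = 2 * \<i> * (C + \<i> * S) * (C + S * z)"
  proof -
    have "circ s * (z + \<i>) - (z - \<i>) = (C + \<i> * S) * (C + \<i> * S) * (z + \<i>) - (C * C + S * S) * (z - \<i>)"
      unfolding circ CS by simp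
    also have "\<dots> = 2 * \<i> * (C + \<i> * S) * (C + S * z)" by (simp add: algebra_simps)
    finally show ?thesis .
  qed
  finally have eq: "(circ s + (z - \<i>) / (z + \<i>)) / (circ s - (z - \<i>) / (z + \<i>)) =
     2 * (C + \<i> * S) * (C * z - S) / (2 * \<i> * (C + \<i> * S) * (C + S * z))" .
  have "C + \<i> * S \<noteq> 0" using circ cis_neq_zero[of "2 * pi * s"] by auto
  then have eq: "\<i> * ((circ s + (z - \<i>) / (z + \<i>)) / (circ s - (z - \<i>) / (z + \<i>))) = (C * z - S) / (C + S * z)"
  proof -
    have "\<i> * (2 * u * v / (2 * \<i> * u * w)) = v / w" if "u \<noteq> 0" for u v w :: complex
      using that by (cases "w = 0") (simp_all add: field_simps)
    with \<open>C + \<i> * S \<noteq> 0\<close> show ?thesis unfolding eq by blast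
  qed
  show ?thesis
  proof (cases "sin (pi * s) = 0")
    case True
    then have "S = 0" by (simp add: S_def)
    moreover from this CS have "C \<noteq> 0" by auto
    ultimately show ?thesis unfolding eq using True by simp
  next
    case False
    then have S: "S \<noteq> 0" by (simp add: S_def)
    have cot: "of_real (- cot (pi * s)) = - C / S" by (simp add: cot_def C_def S_def)
    have "(1 + - C / S * z) / (- C / S - z) = ((S - C * z) / S) / ((- C - S * z) / S)"
      using S by (simp add: diff_divide_distrib)
    also have "\<dots> = - (C * z - S) / - (C + S * z)" using S by simp
    also have "\<dots> = (C * z - S) / (C + S * z)" by (rule minus_divide_divide)
    finally show ?thesis unfolding eq cot using False by simp
  qed
qed

text \<open>
  The measure \<open>M\<close> from the disc is split according to whether \<open>sin (\<pi> s)\<close> vanishes: the mass at infinity yields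
  \<open>b\<close>, the rest is pushed forward to the line by \<open>s \<mapsto> - cot (\<pi> s)\<close>.
\<close>
lemma herglotz_representation:
  assumes h: "herglotz h"
  obtains a b :: real and \<mu> :: "real measure" where "finite_measure \<mu>" "sets \<mu> = sets borel"
    "\<And>z. z \<in> - \<real> \<Longrightarrow> h z = of_real a + of_real b * z + 1 / of_real pi * (\<integral>t. (1 + of_real t * z) / (of_real t - z) \<partial>\<mu>)"
proof -
  have hol: "h holomorphic_on - \<real>" and h_Im: "\<And>z. Im z > 0 \<Longrightarrow> 0 \<le> Im (h z)"
    and h_cnj: "\<And>z. z \<in> - \<real> \<Longrightarrow> cnj (h z) = h (cnj z)"
    using h by (auto simp: herglotz_def complex_is_Real_iff zero_le_divide_iff)
  define F where "F w = - \<i> * h (\<i> * (1 + w) / (1 - w))" for w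
  have "(\<lambda>w. h (\<i> * (1 + w) / (1 - w))) holomorphic_on ball 0 1"
    by (rule holomorphic_on_compose_gen[of "\<lambda>w. \<i> * (1 + w) / (1 - w)" _ h "- \<real>", unfolded o_def])
       (use Im_inverse_Cayley_pos in \<open>fastforce intro!: holomorphic_intros hol simp: complex_is_Real_iff\<close>)+
  then have F: "F holomorphic_on ball 0 1"
    unfolding F_def by (intro holomorphic_intros)
  have F_Re: "0 \<le> Re (F w)" if "norm w < 1" for w
    using h_Im[OF Im_inverse_Cayley_pos(2)[OF that]] by (simp add: F_def)
  obtain M where sets_M [measurable_cong]: "sets M = sets borel" and fin_M: "finite_measure M"
    and rep: "\<And>w. norm w < 1 \<Longrightarrow> F w = \<i> * Im (F 0) + (\<integral>s. (circ s + w) / (circ s - w) \<partial>M)"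
    using Riesz_Herglotz_disc[OF F F_Re] by blast
  interpret M: finite_measure M by (rule fin_M)
  have space_M: "space M = UNIV" using sets_eq_imp_space_eq[OF sets_M] by simp
  define S where "S = {s::real. sin (pi * s) = 0}"
  define T where "T s = - cot (pi * s)" for s :: real
  have S_meas [measurable]: "S \<in> sets borel" unfolding S_def
    by (intro borel_closed closed_Collect_eq continuous_intros)
  have T_meas [measurable]: "T \<in> borel_measurable borel"
    unfolding T_def cot_def
    by (intro borel_measurable_uminus borel_measurable_divide borel_measurable_continuous_onI continuous_intros)
  \<comment> \<open>The factor \<open>pi\<close> anticipates the normalisation \<open>1 / pi\<close> of the representation.\<close>
  define D where "D = density M (\<lambda>s. ennreal (pi * indicator (- S) s))"
  define \<mu> where "\<mu> = distr D borel T"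
  define a where "a = - Im (F 0)"
  define b where "b = measure M S"
  have "finite_measure D"
  proof (rule finite_measureI)
    have "emeasure D (space D) = (\<integral>\<^sup>+s. ennreal (pi * indicator (- S) s) \<partial>M)"
      by (simp add: D_def emeasure_density space_M)
    also have "\<dots> \<le> (\<integral>\<^sup>+s. ennreal pi \<partial>M)"
      by (intro nn_integral_mono ennreal_leI) (auto simp: indicator_def)
    also have "\<dots> < \<infinity>" by (simp add: less_top[symmetric] ennreal_mult_eq_top_iff)
    finally show "emeasure D (space D) \<noteq> \<infinity>" by simp
  qed
  then have fin: "finite_measure \<mu>"
    unfolding \<mu>_def by (rule finite_measure.finite_measure_distr) (simp add: D_def)
  have sets_\<mu>: "sets \<mu> = sets borel" by (simp add: \<mu>_def)
  have upper: "h z = of_real a + of_real b * z + 1 / of_real pi * (\<integral>t. (1 + of_real t * z) / (of_real t - z) \<partial>\<mu>)"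
    if z: "Im z > 0" for z
  proof -
    let ?w = "(z - \<i>) / (z + \<i>)" and ?k = "\<lambda>t. (1 + of_real t * z) / (of_real t - z)"
    have k_meas [measurable]: "?k \<in> borel_measurable borel" by measurable
    obtain B where B: "\<And>t::real. norm (?k t) \<le> B"
      using Herglotz_kernel_bounded[of z] z by auto
    have iS: "integrable M (\<lambda>s. indicator S s *\<^sub>R z)"
      by (rule M.integrable_const_bound[of _ "norm z"]) (auto simp: indicator_def)
    have ik: "integrable M (\<lambda>s. indicator (- S) s *\<^sub>R ?k (T s))"
      by (rule M.integrable_const_bound[of _ B]) (use B order_trans[OF norm_ge_zero B] in \<open>auto simp: indicator_def\<close>)
    have "h z = \<i> * F ?w"
      using Cayley_in_disc(2)[OF z] by (simp add: F_def)
    also have "\<dots> = of_real a + \<i> * (\<integral>s. (circ s + ?w) / (circ s - ?w) \<partial>M)"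
      using rep[OF Cayley_in_disc(1)[OF z]] by (simp add: a_def algebra_simps)
    also have "\<i> * (\<integral>s. (circ s + ?w) / (circ s - ?w) \<partial>M) = (\<integral>s. \<i> * ((circ s + ?w) / (circ s - ?w)) \<partial>M)"
      by (rule integral_mult_right_zero[symmetric])
    also have "\<dots> = (\<integral>s. indicator S s *\<^sub>R z + indicator (- S) s *\<^sub>R ?k (T s) \<partial>M)"
      by (intro Bochner_Integration.integral_cong) (auto simp only: Schwarz_kernel_Cayley[OF z] S_def T_def indicator_def split: if_splits, auto)
    also have "\<dots> = (\<integral>s. indicator S s *\<^sub>R z \<partial>M) + (\<integral>s. indicator (- S) s *\<^sub>R ?k (T s) \<partial>M)"
      by (rule Bochner_Integration.integral_add[OF iS ik])
    also have "(\<integral>s. indicator S s *\<^sub>R z \<partial>M) = of_real b * z"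
      by (simp add: b_def scaleR_conv_of_real sets_M)
    also have "(\<integral>s. indicator (- S) s *\<^sub>R ?k (T s) \<partial>M) = 1 / of_real pi * (\<integral>t. ?k t \<partial>\<mu>)"
    proof -
      have "(\<integral>t. ?k t \<partial>\<mu>) = (\<integral>s. ?k (T s) \<partial>D)"
        unfolding \<mu>_def by (rule integral_distr) (simp_all add: D_def)
      also have "\<dots> = (\<integral>s. (pi * indicator (- S) s) *\<^sub>R ?k (T s) \<partial>M)"
        unfolding D_def by (rule integral_density) auto
      also have "\<dots> = pi *\<^sub>R (\<integral>s. indicator (- S) s *\<^sub>R ?k (T s) \<partial>M)"
        unfolding scaleR_scaleR[symmetric] by (rule Bochner_Integration.integral_scaleR_right)
      finally show ?thesis by (simp add: scaleR_conv_of_real)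
    qed
    finally show ?thesis by (simp add: add.assoc)
  qed
  have "h z = of_real a + of_real b * z + 1 / of_real pi * (\<integral>t. (1 + of_real t * z) / (of_real t - z) \<partial>\<mu>)"
    if "z \<in> - \<real>" for z
  proof (cases "Im z > 0")
    case False
    have "cnj z \<in> - \<real>" using that by (simp add: complex_is_Real_iff)
    from h_cnj[OF this] have "h z = cnj (h (cnj z))" by simp
    also have "\<dots> = cnj (of_real a + of_real b * cnj z + 1 / of_real pi * (\<integral>t. (1 + of_real t * cnj z) / (of_real t - cnj z) \<partial>\<mu>))"
      using False that by (subst upper) (auto simp: complex_is_Real_iff)
    also have "\<dots> = of_real a + of_real b * z + 1 / of_real pi * (\<integral>t. (1 + of_real t * z) / (of_real t - z) \<partial>\<mu>)"
      by (simp add: cnj_integral_Herglotz_kernel)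
    finally show ?thesis .
  qed (rule upper)
  with fin sets_\<mu> show ?thesis by (rule that)
qed

section \<open>Stieltjes inversion and uniqueness\<close>

lemma interval_integral_Poisson_kernel:
  assumes y: "y > 0" and cd: "c \<le> d"
  shows "(\<integral>x. y / ((t - x)\<^sup>2 + y\<^sup>2) * indicator {c..d} x \<partial>lborel) = arctan ((d - t) / y) - arctan ((c - t) / y)"
proof (rule integral_FTC_Icc_real[OF cd])
  have pos: "(t - x)\<^sup>2 + y\<^sup>2 > 0" for x
    using y by (simp add: add_nonneg_pos)
  show "DERIV (\<lambda>x. arctan ((x - t) / y)) x :> y / ((t - x)\<^sup>2 + y\<^sup>2)" for x
  proof -
    have "DERIV (\<lambda>x. arctan ((x - t) / y)) x :> inverse (1 + ((x - t) / y)\<^sup>2) * (1 / y)"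
      using y by (auto intro!: derivative_eq_intros)
    also have "inverse (1 + ((x - t) / y)\<^sup>2) * (1 / y) = y / ((t - x)\<^sup>2 + y\<^sup>2)"
      using y pos[of x] by (simp add: field_simps power2_eq_square)
    finally show ?thesis .
  qed
  show "isCont (\<lambda>x. y / ((t - x)\<^sup>2 + y\<^sup>2)) x" for x
    using pos[of x] by (intro continuous_intros) auto
qed

text \<open>
  Fubini's theorem, applied to integrating the Poisson integral at height \<open>y\<close> over the interval
  from \<open>c\<close> to \<open>d\<close>. Everything is bounded and both measures are finite.
\<close>
lemma integral_Poisson_integral:
  fixes \<mu> :: "real measure"
  assumes fin: "finite_measure \<mu>" and sets [measurable_cong]: "sets \<mu> = sets borel"
    and y: "y > 0" and cd: "c \<le> d"
  shows "(\<integral>x. (\<integral>t. y / ((t - x)\<^sup>2 + y\<^sup>2) \<partial>\<mu>) \<partial>density lborel (indicator {c..d})) =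
           (\<integral>t. arctan ((d - t) / y) - arctan ((c - t) / y) \<partial>\<mu>)"
proof -
  define L where "L = density lborel (\<lambda>x. ennreal (indicator {c..d} x))"
  have setsL [measurable_cong]: "sets L = sets borel" by (simp add: L_def)
  interpret \<mu>: finite_measure \<mu> by (rule fin)
  interpret L: finite_measure L
    by (rule finite_measureI) (use cd in \<open>simp add: L_def emeasure_density ennreal_indicator\<close>)
  interpret P: pair_sigma_finite \<mu> L ..
  interpret PF: finite_measure "\<mu> \<Otimes>\<^sub>M L"
    by (intro finite_measure_pair_measure fin L.finite_measure_axioms)
  have p_le: "\<bar>y / ((t - x)\<^sup>2 + y\<^sup>2)\<bar> \<le> 1 / y" for t x
  proof -
    have "y / ((t - x)\<^sup>2 + y\<^sup>2) \<le> y / y\<^sup>2"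
      using y by (intro divide_left_mono) (auto intro!: mult_pos_pos add_nonneg_pos)
    then show ?thesis using y by (simp add: power2_eq_square)
  qed
  have "integrable (\<mu> \<Otimes>\<^sub>M L) (\<lambda>(t, x). y / ((t - x)\<^sup>2 + y\<^sup>2))"
    by (rule PF.integrable_const_bound[of _ "1 / y"]) (use p_le in auto)
  from P.Fubini_integral[OF this]
  have "(\<integral>x. (\<integral>t. y / ((t - x)\<^sup>2 + y\<^sup>2) \<partial>\<mu>) \<partial>L) = (\<integral>t. (\<integral>x. y / ((t - x)\<^sup>2 + y\<^sup>2) \<partial>L) \<partial>\<mu>)"
    by simp
  also have "\<dots> = (\<integral>t. arctan ((d - t) / y) - arctan ((c - t) / y) \<partial>\<mu>)"
    unfolding interval_integral_Poisson_kernel[OF y cd, symmetric] L_def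
    by (subst integral_density) (auto simp: mult.commute)
  finally show ?thesis by (simp add: L_def ennreal_indicator)
qed

text \<open>
  Stieltjes inversion. The point \<open>x\<close> is approached from the right by \<open>1 / m\<close> while the height
  decreases like \<open>1 / m\<^sup>2\<close>: the quotient of the two tends to infinity, so that a point mass at \<open>x\<close> is
  counted in full instead of being halved. The left end \<open>- m\<close> of the interval tends to minus infinity, so
  that the limit is the distribution function itself.
\<close>
lemma cdf_eq_Poisson_limit:
  fixes \<mu> :: "real measure"
  assumes fin: "finite_measure \<mu>" and sets [measurable_cong]: "sets \<mu> = sets borel"
  shows "(\<lambda>n. \<integral>t. arctan ((x + 1 / real (n+2) - t) / (1 / real (n+2) ^ 2)) -
                arctan ((- real (n+2) - t) / (1 / real (n+2) ^ 2)) \<partial>\<mu>) \<longlonglongrightarrow> pi * cdf \<mu> x"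
proof -
  interpret finite_measure \<mu> by (rule fin)
  have "(\<lambda>n. \<integral>t. arctan ((x + 1 / real (n+2) - t) / (1 / real (n+2) ^ 2)) -
                arctan ((- real (n+2) - t) / (1 / real (n+2) ^ 2)) \<partial>\<mu>) \<longlonglongrightarrow> (\<integral>t. pi * indicator {..x} t \<partial>\<mu>)"
  proof (rule integral_dominated_convergence[where w="\<lambda>_. pi"])
    show "AE t in \<mu>. (\<lambda>n. arctan ((x + 1 / real (n+2) - t) / (1 / real (n+2) ^ 2)) -
                arctan ((- real (n+2) - t) / (1 / real (n+2) ^ 2))) \<longlonglongrightarrow> pi * indicator {..x} t"
    proof (rule AE_I2)
      fix t
      have 1: "(\<lambda>n. arctan ((- real (n+2) - t) / (1 / real (n+2) ^ 2))) \<longlonglongrightarrow> - (pi / 2)"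
        by (rule filterlim_compose[OF tendsto_arctan_at_bot]) real_asymp
      have 2: "(\<lambda>n. arctan ((x + 1 / real (n+2) - t) / (1 / real (n+2) ^ 2))) \<longlonglongrightarrow> (if t \<le> x then pi / 2 else - (pi / 2))"
      proof -
        define u where "u = x - t"
        have eq: "x + 1 / real (n+2) - t = u + 1 / real (n+2)" for n by (simp add: u_def)
        consider "u > 0" | "u = 0" | "u < 0" by linarith
        then show ?thesis
        proof cases
          case 1
          then have "filterlim (\<lambda>n. (u + 1 / real (n+2)) / (1 / real (n+2) ^ 2)) at_top sequentially" by real_asymp
          with 1 show ?thesis unfolding eq by (simp add: u_def filterlim_compose[OF tendsto_arctan_at_top])
        next
          case 2
          have "filterlim (\<lambda>n. (0 + 1 / real (n+2)) / (1 / real (n+2) ^ 2)) at_top sequentially" by real_asymp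
          with 2 show ?thesis unfolding eq by (simp add: u_def filterlim_compose[OF tendsto_arctan_at_top])
        next
          case 3
          then have "filterlim (\<lambda>n. (u + 1 / real (n+2)) / (1 / real (n+2) ^ 2)) at_bot sequentially" by real_asymp
          with 3 show ?thesis unfolding eq by (simp add: u_def filterlim_compose[OF tendsto_arctan_at_bot])
        qed
      qed
      show "(\<lambda>n. arctan ((x + 1 / real (n+2) - t) / (1 / real (n+2) ^ 2)) -
                arctan ((- real (n+2) - t) / (1 / real (n+2) ^ 2))) \<longlonglongrightarrow> pi * indicator {..x} t"
        using tendsto_diff[OF 2 1] by (cases "t \<le> x") (simp_all del: of_nat_add)
    qed
    show "AE t in \<mu>. norm (arctan ((x + 1 / real (n+2) - t) / (1 / real (n+2) ^ 2)) -
                arctan ((- real (n+2) - t) / (1 / real (n+2) ^ 2))) \<le> pi" for n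
    proof (rule AE_I2)
      have "\<bar>arctan a - arctan b\<bar> \<le> pi" for a b :: real
        using arctan_bounded[of a] arctan_bounded[of b] by (simp add: abs_le_iff)
      then show "norm (arctan ((x + 1 / real (n+2) - t) / (1 / real (n+2) ^ 2)) -
                arctan ((- real (n+2) - t) / (1 / real (n+2) ^ 2))) \<le> pi" for t
        unfolding real_norm_def .
    qed
  qed auto
  also have "(\<integral>t. pi * indicator {..x} t \<partial>\<mu>) = pi * cdf \<mu> x"
    by (simp add: cdf_def sets)
  finally show ?thesis .
qed

text \<open>
  Restricting the heights to below \<open>1\<close> keeps clear of the points \<open>\<i>\<close> and \<open>- \<i>\<close>, at
  which the representation carries no information about the Cauchy transform.
\<close>
lemma finite_measure_eqI_Poisson:
  fixes \<mu> \<nu> :: "real measure"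
  assumes \<mu>: "finite_measure \<mu>" "sets \<mu> = sets borel" and \<nu>: "finite_measure \<nu>" "sets \<nu> = sets borel"
    and eq: "\<And>x y. 0 < y \<Longrightarrow> y < 1 \<Longrightarrow>
      (\<integral>t. y / ((t - x)\<^sup>2 + y\<^sup>2) \<partial>\<mu>) = (\<integral>t. y / ((t - x)\<^sup>2 + y\<^sup>2) \<partial>\<nu>)"
  shows "\<mu> = \<nu>"
proof (rule cdf_unique')
  show "finite_borel_measure \<mu>" "finite_borel_measure \<nu>"
    using \<mu> \<nu> by (auto simp: finite_borel_measure_def finite_borel_measure_axioms_def)
  show "cdf \<mu> = cdf \<nu>"
  proof
    fix x
    let ?y = "\<lambda>n. 1 / real (n+2) ^ 2"
    let ?A = "\<lambda>n t. arctan ((x + 1 / real (n+2) - t) / ?y n) - arctan ((- real (n+2) - t) / ?y n)"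
    have "\<forall>\<^sub>F n in sequentially. - real (n+2) \<le> x + 1 / real (n+2)" by real_asymp
    then have "\<forall>\<^sub>F n in sequentially. (\<integral>t. ?A n t \<partial>\<mu>) = (\<integral>t. ?A n t \<partial>\<nu>)"
    proof eventually_elim
      case (elim n)
      have "1 < real (n + 2) ^ 2" by (rule one_less_power) auto
      then have y: "0 < ?y n" "?y n < 1" by (auto simp: divide_less_eq)
      show ?case
        unfolding integral_Poisson_integral[OF \<mu> y(1) elim, symmetric] integral_Poisson_integral[OF \<nu> y(1) elim, symmetric] eq[OF y] ..
    qed
    with cdf_eq_Poisson_limit[OF \<mu>, of x] have "(\<lambda>n. \<integral>t. ?A n t \<partial>\<nu>) \<longlonglongrightarrow> pi * cdf \<mu> x"
      by (rule Lim_transform_eventually)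
    then show "cdf \<mu> x = cdf \<nu> x"
      using LIMSEQ_unique[OF _ cdf_eq_Poisson_limit[OF \<nu>, of x]] by fastforce
  qed
qed

lemma signed_measure_eqI_Poisson:
  fixes P N P' N' :: "real measure"
  assumes fin: "finite_measure P" "finite_measure N" "finite_measure P'" "finite_measure N'"
    and sets: "sets P = sets borel" "sets N = sets borel" "sets P' = sets borel" "sets N' = sets borel"
    and eq: "\<And>x y. 0 < y \<Longrightarrow> y < 1 \<Longrightarrow>
      (\<integral>t. y / ((t - x)\<^sup>2 + y\<^sup>2) \<partial>P) - (\<integral>t. y / ((t - x)\<^sup>2 + y\<^sup>2) \<partial>N) =
      (\<integral>t. y / ((t - x)\<^sup>2 + y\<^sup>2) \<partial>P') - (\<integral>t. y / ((t - x)\<^sup>2 + y\<^sup>2) \<partial>N')"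
  shows "measure P A - measure N A = measure P' A - measure N' A"
proof -
  have int: "integrable Q (\<lambda>t. y / ((t - x)\<^sup>2 + y\<^sup>2))" if "finite_measure Q" "sets Q = sets borel" "0 < y" for Q :: "real measure" and x y
  proof -
    have "integrable Q (\<lambda>t. Im (1 / (of_real t - Complex x y)))"
      using that by (intro integrable_Im integrable_Cauchy_kernel) auto
    then show ?thesis unfolding Im_Cauchy_kernel by simp
  qed
  have "measure_sum P N' = measure_sum P' N"
  proof (rule finite_measure_eqI_Poisson)
    show "finite_measure (measure_sum P N')" "finite_measure (measure_sum P' N)"
      using fin sets by (auto intro!: finite_measure_measure_sum)
    show "sets (measure_sum P N') = sets borel" "sets (measure_sum P' N) = sets borel"
      using sets by simp_all
    fix x y :: real assume y: "0 < y" "y < 1"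
    show "(\<integral>t. y / ((t - x)\<^sup>2 + y\<^sup>2) \<partial>measure_sum P N') = (\<integral>t. y / ((t - x)\<^sup>2 + y\<^sup>2) \<partial>measure_sum P' N)"
      using eq[OF y, of x] int[OF _ _ y(1)] fin sets by (simp add: integral_measure_sum_real)
  qed
  then have "emeasure (measure_sum P N') A = emeasure (measure_sum P' N) A" by simp
  then have "measure P A + measure N' A = measure P' A + measure N A"
    using fin sets
    by (simp add: emeasure_measure_sum finite_measure.emeasure_eq_measure ennreal_plus[symmetric] del: ennreal_plus)
  then show ?thesis by simp
qed

text \<open>
  For a positive measure the two values are conjugate, so that their difference is twice the
  imaginary part, which is the Poisson integral.
\<close>
lemma Cauchy_transform_diff_cnj:
  assumes Q: "finite_measure Q" "sets Q = sets borel" and z: "Im z \<noteq> 0"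
  shows "(\<integral>t. 1 / (of_real t - z) \<partial>Q) - (\<integral>t. 1 / (of_real t - cnj z) \<partial>Q) =
    2 * \<i> * of_real (\<integral>t. Im z / ((t - Re z)\<^sup>2 + (Im z)\<^sup>2) \<partial>Q)"
proof -
  have "(\<integral>t. 1 / (of_real t - cnj z) \<partial>Q) = cnj (\<integral>t. 1 / (of_real t - z) \<partial>Q)"
    by (rule cnj_integral_Cauchy_kernel[symmetric])
  moreover have "Im (\<integral>t. 1 / (of_real t - z) \<partial>Q) = (\<integral>t. Im z / ((t - Re z)\<^sup>2 + (Im z)\<^sup>2) \<partial>Q)"
    using integral_Im[OF integrable_Cauchy_kernel[OF Q z]] unfolding Im_Cauchy_kernel by simp
  ultimately show ?thesis by (simp add: complex_eq_iff)
qed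

lemma complex_measure_eqI_Cauchy:
  assumes \<nu>: "complex_measure borel \<nu>" and \<nu>': "complex_measure borel \<nu>'"
    and eq: "\<And>z. z \<in> - \<real> \<Longrightarrow> \<bar>Im z\<bar> < 1 \<Longrightarrow>
      complex_measure_integral borel \<nu> (\<lambda>t. 1 / (of_real t - z)) =
      complex_measure_integral borel \<nu>' (\<lambda>t. 1 / (of_real t - z))"
  shows "\<nu> = \<nu>'"
proof -
  from complex_measure_decomposition[OF \<nu>] obtain P1 N1 P2 N2 where
    fin: "finite_measure P1" "finite_measure N1" "finite_measure P2" "finite_measure N2" and
    sets: "sets P1 = sets borel" "sets N1 = sets borel" "sets P2 = sets borel" "sets N2 = sets borel" and
    \<nu>_eq: "\<And>A. \<nu> A = of_real (measure P1 A - measure N1 A) + \<i> * of_real (measure P2 A - measure N2 A)" and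
    int: "\<And>f. complex_measure_integral borel \<nu> f =
       (integral\<^sup>L P1 f - integral\<^sup>L N1 f) + \<i> * (integral\<^sup>L P2 f - integral\<^sup>L N2 f)" by blast
  from complex_measure_decomposition[OF \<nu>'] obtain P1' N1' P2' N2' where
    fin': "finite_measure P1'" "finite_measure N1'" "finite_measure P2'" "finite_measure N2'" and
    sets': "sets P1' = sets borel" "sets N1' = sets borel" "sets P2' = sets borel" "sets N2' = sets borel" and
    \<nu>'_eq: "\<And>A. \<nu>' A = of_real (measure P1' A - measure N1' A) + \<i> * of_real (measure P2' A - measure N2' A)" and
    int': "\<And>f. complex_measure_integral borel \<nu>' f =
       (integral\<^sup>L P1' f - integral\<^sup>L N1' f) + \<i> * (integral\<^sup>L P2' f - integral\<^sup>L N2' f)" by blast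
  define p where "p Q x y = (\<integral>t. y / ((t - x)\<^sup>2 + y\<^sup>2) \<partial>Q)" for Q and x y :: real
  have p: "p P1 x y - p N1 x y = p P1' x y - p N1' x y \<and> p P2 x y - p N2 x y = p P2' x y - p N2' x y"
    if y: "0 < y" "y < 1" for x y
  proof -
    define z where "z = Complex x y"
    have z: "Im z \<noteq> 0" "z \<in> - \<real>" "cnj z \<in> - \<real>" "\<bar>Im z\<bar> < 1" "\<bar>Im (cnj z)\<bar> < 1"
      using y by (auto simp: z_def complex_is_Real_iff)
    have d: "(\<integral>t. 1 / (of_real t - z) \<partial>Q) = (\<integral>t. 1 / (of_real t - cnj z) \<partial>Q) + 2 * \<i> * of_real (p Q x y)"
      if "finite_measure Q" "sets Q = sets borel" for Q
      using Cauchy_transform_diff_cnj[OF that z(1)]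
      by (simp add: p_def z_def algebra_simps)
    note ds = d[OF fin(1) sets(1)] d[OF fin(2) sets(2)] d[OF fin(3) sets(3)] d[OF fin(4) sets(4)]
      d[OF fin'(1) sets'(1)] d[OF fin'(2) sets'(2)] d[OF fin'(3) sets'(3)] d[OF fin'(4) sets'(4)]
    have "complex_measure_integral borel \<nu> (\<lambda>t. 1 / (of_real t - z)) -
        complex_measure_integral borel \<nu> (\<lambda>t. 1 / (of_real t - cnj z)) =
       2 * \<i> * (of_real (p P1 x y - p N1 x y) + \<i> * of_real (p P2 x y - p N2 x y))"
      unfolding int ds by (simp add: algebra_simps)
    moreover have "complex_measure_integral borel \<nu>' (\<lambda>t. 1 / (of_real t - z)) -
        complex_measure_integral borel \<nu>' (\<lambda>t. 1 / (of_real t - cnj z)) =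
       2 * \<i> * (of_real (p P1' x y - p N1' x y) + \<i> * of_real (p P2' x y - p N2' x y))"
      unfolding int' ds by (simp add: algebra_simps)
    ultimately have "2 * \<i> * (of_real (p P1 x y - p N1 x y) + \<i> * of_real (p P2 x y - p N2 x y)) =
       2 * \<i> * (of_real (p P1' x y - p N1' x y) + \<i> * of_real (p P2' x y - p N2' x y))"
      using eq[OF z(2,4)] eq[OF z(3,5)] by (simp only:)
    then have "of_real (p P1 x y - p N1 x y) + \<i> * of_real (p P2 x y - p N2 x y) =
       of_real (p P1' x y - p N1' x y) + \<i> * of_real (p P2' x y - p N2' x y)"
      by (simp only: mult_cancel_left) simp
    then show ?thesis by (simp add: complex_eq_iff)
  qed
  have "measure P1 A - measure N1 A = measure P1' A - measure N1' A"
       "measure P2 A - measure N2 A = measure P2' A - measure N2' A" for A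
    using p unfolding p_def
    by (intro signed_measure_eqI_Poisson fin fin' sets sets'; blast)+
  then show ?thesis by (intro ext) (simp add: \<nu>_eq \<nu>'_eq)
qed

text \<open>
  In this form the unknown data separate: the last summand vanishes at \<open>\<i>\<close> and \<open>- \<i>\<close>, whereas
  elsewhere it gives the Cauchy transform of \<open>\<nu>\<close>.
\<close>
lemma integral_representation_Cauchy:
  assumes \<nu>: "complex_measure borel \<nu>" and rep: "integral_representation q a b \<nu>" and z: "z \<in> - \<real>"
  shows "q z = a + (b + \<nu> UNIV / of_real pi) * z +
     (1 + z\<^sup>2) / of_real pi * complex_measure_integral borel \<nu> (\<lambda>t. 1 / (of_real t - z))"
proof -
  from complex_measure_decomposition[OF \<nu>] obtain P1 N1 P2 N2 where
    fin: "finite_measure P1" "finite_measure N1" "finite_measure P2" "finite_measure N2" and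
    sets: "sets P1 = sets borel" "sets N1 = sets borel" "sets P2 = sets borel" "sets N2 = sets borel" and
    \<nu>_eq: "\<And>A. \<nu> A = of_real (measure P1 A - measure N1 A) + \<i> * of_real (measure P2 A - measure N2 A)" and
    int: "\<And>f. complex_measure_integral borel \<nu> f =
       (integral\<^sup>L P1 f - integral\<^sup>L N1 f) + \<i> * (integral\<^sup>L P2 f - integral\<^sup>L N2 f)" by blast
  have Im: "Im z \<noteq> 0" using z by (simp add: complex_is_Real_iff)
  note i = integral_Herglotz_kernel[OF _ _ Im]
  have "complex_measure_integral borel \<nu> (\<lambda>t. (1 + of_real t * z) / (of_real t - z)) =
     \<nu> UNIV * z + (1 + z\<^sup>2) * complex_measure_integral borel \<nu> (\<lambda>t. 1 / (of_real t - z))"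
    unfolding int i[OF fin(1) sets(1)] i[OF fin(2) sets(2)] i[OF fin(3) sets(3)] i[OF fin(4) sets(4)] \<nu>_eq
    by (simp add: algebra_simps)
  moreover have "q z = a + b * z + 1 / of_real pi * complex_measure_integral borel \<nu> (\<lambda>t. (1 + of_real t * z) / (of_real t - z))"
    using rep z by (simp add: integral_representation_def)
  ultimately show ?thesis by (simp add: add_divide_distrib algebra_simps)
qed

lemma integral_representation_unique:
  assumes \<nu>: "complex_measure borel \<nu>" and rep: "integral_representation q a b \<nu>"
    and \<nu>': "complex_measure borel \<nu>'" and rep': "integral_representation q a' b' \<nu>'"
  shows "a = a' \<and> b = b' \<and> \<nu> = \<nu>'"
proof -
  note q = integral_representation_Cauchy[OF \<nu> rep] and q' = integral_representation_Cauchy[OF \<nu>' rep']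
  \<comment> \<open>The two coefficients of \<open>z\<close> left over at \<open>\<i>\<close> and \<open>- \<i>\<close>; \<open>b\<close> itself is not accessible before \<open>\<nu>\<close> is known.\<close>
  define B where "B = b + \<nu> UNIV / of_real pi"
  define B' where "B' = b' + \<nu>' UNIV / of_real pi"
  have "a + B * \<i> = a' + B' * \<i>" "a - B * \<i> = a' - B' * \<i>"
    using q[of \<i>] q'[of \<i>] q[of "- \<i>"] q'[of "- \<i>"] by (simp_all add: complex_is_Real_iff B_def B'_def)
  then have "2 * a = 2 * a'" "2 * \<i> * B = 2 * \<i> * B'"
    by (algebra+)
  then have a: "a = a'" and B: "B = B'" by simp_all
  have "\<nu> = \<nu>'"
  proof (rule complex_measure_eqI_Cauchy[OF \<nu> \<nu>'])
    fix z :: complex assume z: "z \<in> - \<real>" "\<bar>Im z\<bar> < 1"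
    have "1 + z\<^sup>2 \<noteq> 0"
    proof
      assume "1 + z\<^sup>2 = 0"
      then have "(z - \<i>) * (z + \<i>) = 0" by (simp add: algebra_simps power2_eq_square)
      then have "z = \<i> \<or> z = - \<i>" by (auto simp: eq_neg_iff_add_eq_0)
      then show False using z(2) by auto
    qed
    then show "complex_measure_integral borel \<nu> (\<lambda>t. 1 / (of_real t - z)) =
      complex_measure_integral borel \<nu>' (\<lambda>t. 1 / (of_real t - z))"
      using q[OF z(1)] q'[OF z(1)] a B by (simp add: B_def[symmetric] B'_def[symmetric])
  qed
  with a B show ?thesis by (simp add: B_def B'_def)
qed

section \<open>Quasi-Herglotz functions\<close>

text \<open>
  The linear coefficients of Herglotz functions are nonnegative, so that real and imaginary part of \<open>b\<close> are
  split into positive and negative part; the real constants impose no such condition.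
\<close>
lemma quasi_herglotz_of_representation:
  assumes \<nu>: "complex_measure borel \<nu>" and rep: "integral_representation q a b \<nu>"
  shows "quasi_herglotz q"
proof -
  from complex_measure_decomposition[OF \<nu>] obtain P1 N1 P2 N2 where
    fin: "finite_measure P1" "finite_measure N1" "finite_measure P2" "finite_measure N2" and
    sets: "sets P1 = sets borel" "sets N1 = sets borel" "sets P2 = sets borel" "sets N2 = sets borel" and
    \<nu>_eq: "\<And>A. \<nu> A = of_real (measure P1 A - measure N1 A) + \<i> * of_real (measure P2 A - measure N2 A)" and
    int: "\<And>f. complex_measure_integral borel \<nu> f =
       (integral\<^sup>L P1 f - integral\<^sup>L N1 f) + \<i> * (integral\<^sup>L P2 f - integral\<^sup>L N2 f)" by blast
  define H where "H \<alpha> \<beta> Q z = complex_of_real \<alpha> + of_real \<beta> * z + 1 / of_real pi * (\<integral>t. (1 + of_real t * z) / (of_real t - z) \<partial>Q)"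
    for \<alpha> \<beta> Q z
  have H: "herglotz (H \<alpha> \<beta> Q)" if "finite_measure Q" "sets Q = sets borel" "0 \<le> \<beta>" for \<alpha> \<beta> Q
    unfolding H_def by (rule herglotz_of_representation[OF that])
  have max: "of_real (max r 0) = of_real r + complex_of_real (max (- r) 0)" for r
    by (simp add: max_def)
  obtain a1 a2 b1 b2 :: real where a: "a = of_real a1 + \<i> * of_real a2" and b: "b = of_real b1 + \<i> * of_real b2"
    using complex_eq by blast
  have q: "q z = (H a1 (max b1 0) P1 z - H 0 (max (- b1) 0) N1 z) +
      \<i> * (H a2 (max b2 0) P2 z - H 0 (max (- b2) 0) N2 z)" if z: "z \<in> - \<real>" for z
  proof -
    have "q z = a + b * z + 1 / of_real pi * complex_measure_integral borel \<nu> (\<lambda>t. (1 + of_real t * z) / (of_real t - z))"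
      using rep z by (simp add: integral_representation_def)
    also have "\<dots> = (H a1 (max b1 0) P1 z - H 0 (max (- b1) 0) N1 z) +
        \<i> * (H a2 (max b2 0) P2 z - H 0 (max (- b2) 0) N2 z)"
      unfolding int H_def max[of b1] max[of b2] a b by (simp only: algebra_simps of_real_0 add_0_left)
    finally show ?thesis .
  qed
  show ?thesis
    unfolding quasi_herglotz_def
    by (rule exI[of _ "H a1 (max b1 0) P1"], rule exI[of _ "H 0 (max (- b1) 0) N1"],
        rule exI[of _ "H a2 (max b2 0) P2"], rule exI[of _ "H 0 (max (- b2) 0) N2"])
       (intro conjI ballI H fin sets q max.cobounded2)
qed

lemma representation_of_quasi_herglotz:
  assumes "quasi_herglotz q"
  shows "\<exists>a b \<nu>. complex_measure borel \<nu> \<and> integral_representation q a b \<nu>"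
proof -
  obtain h1 h2 h3 h4 where h: "herglotz h1" "herglotz h2" "herglotz h3" "herglotz h4"
    and q: "\<And>z. z \<in> - \<real> \<Longrightarrow> q z = (h1 z - h2 z) + \<i> * (h3 z - h4 z)"
    using assms by (auto simp: quasi_herglotz_def)
  let ?k = "\<lambda>z t. (1 + complex_of_real t * z) / (of_real t - z)"
  obtain a1 b1 :: real and P1 where 1: "finite_measure P1" "sets P1 = sets borel"
    "\<And>z. z \<in> - \<real> \<Longrightarrow> h1 z = of_real a1 + of_real b1 * z + 1 / of_real pi * integral\<^sup>L P1 (?k z)"
    by (rule herglotz_representation[OF h(1)]) (rule that)
  obtain a2 b2 :: real and N1 where 2: "finite_measure N1" "sets N1 = sets borel"
    "\<And>z. z \<in> - \<real> \<Longrightarrow> h2 z = of_real a2 + of_real b2 * z + 1 / of_real pi * integral\<^sup>L N1 (?k z)"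
    by (rule herglotz_representation[OF h(2)]) (rule that)
  obtain a3 b3 :: real and P2 where 3: "finite_measure P2" "sets P2 = sets borel"
    "\<And>z. z \<in> - \<real> \<Longrightarrow> h3 z = of_real a3 + of_real b3 * z + 1 / of_real pi * integral\<^sup>L P2 (?k z)"
    by (rule herglotz_representation[OF h(3)]) (rule that)
  obtain a4 b4 :: real and N2 where 4: "finite_measure N2" "sets N2 = sets borel"
    "\<And>z. z \<in> - \<real> \<Longrightarrow> h4 z = of_real a4 + of_real b4 * z + 1 / of_real pi * integral\<^sup>L N2 (?k z)"
    by (rule herglotz_representation[OF h(4)]) (rule that)
  define \<nu> where "\<nu> A = complex_of_real (measure P1 A - measure N1 A) + \<i> * of_real (measure P2 A - measure N2 A)" for A
  define a where "a = complex_of_real (a1 - a2) + \<i> * of_real (a3 - a4)"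
  define b where "b = complex_of_real (b1 - b2) + \<i> * of_real (b3 - b4)"
  note \<nu>_props = complex_measure_of_positive[OF 1(1) 2(1) 3(1) 4(1) 1(2) 2(2) 3(2) 4(2), folded \<nu>_def]
  have "complex_measure borel \<nu>"
    by (rule \<nu>_props(1))
  moreover have "integral_representation q a b \<nu>"
    unfolding integral_representation_def
  proof
    fix z :: complex assume z: "z \<in> - \<real>"
    then have "Im z \<noteq> 0" by (simp add: complex_is_Real_iff)
    from Herglotz_kernel_bounded[OF this] obtain B where B: "\<And>t. norm (?k z t) \<le> B" by blast
    have int: "complex_measure_integral borel \<nu> (?k z) =
       (integral\<^sup>L P1 (?k z) - integral\<^sup>L N1 (?k z)) + \<i> * (integral\<^sup>L P2 (?k z) - integral\<^sup>L N2 (?k z))"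
      by (rule \<nu>_props(2)[OF _ B]) measurable
    show "q z = a + b * z + 1 / of_real pi * complex_measure_integral borel \<nu> (?k z)"
      unfolding q[OF z] 1(3)[OF z] 2(3)[OF z] 3(3)[OF z] 4(3)[OF z] int a_def b_def
      by (simp add: algebra_simps add_divide_distrib diff_divide_distrib)
  qed
  ultimately show ?thesis by blast
qed

theorem theorem3p4:
  fixes q :: "complex \<Rightarrow> complex"
  shows "(quasi_herglotz q \<longleftrightarrow>
            (\<exists>a b \<nu>. complex_measure borel \<nu> \<and> integral_representation q a b \<nu>)) \<and>
         (quasi_herglotz q \<longrightarrow>
            (\<exists>!(a, b, \<nu>). complex_measure borel \<nu> \<and> integral_representation q a b \<nu>))"
proof (intro conjI iffI impI)
  assume "quasi_herglotz q"
  then show ex: "\<exists>a b \<nu>. complex_measure borel \<nu> \<and> integral_representation q a b \<nu>"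
    by (rule representation_of_quasi_herglotz)
  then obtain a b \<nu> where *: "complex_measure borel \<nu>" "integral_representation q a b \<nu>" by blast
  show "\<exists>!(a, b, \<nu>). complex_measure borel \<nu> \<and> integral_representation q a b \<nu>"
  proof (rule ex1I[of _ "(a, b, \<nu>)"])
    show "case (a, b, \<nu>) of (a, b, \<nu>) \<Rightarrow> complex_measure borel \<nu> \<and> integral_representation q a b \<nu>"
      using * by simp
    fix t assume t: "case t of (a, b, \<nu>) \<Rightarrow> complex_measure borel \<nu> \<and> integral_representation q a b \<nu>"
    obtain a' b' \<nu>' where t_eq: "t = (a', b', \<nu>')" by (rule prod_cases3)
    then have "complex_measure borel \<nu>'" "integral_representation q a' b' \<nu>'" using t by simp_all
    from integral_representation_unique[OF this *] show "t = (a, b, \<nu>)" by (simp add: t_eq)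
  qed
next
  assume "\<exists>a b \<nu>. complex_measure borel \<nu> \<and> integral_representation q a b \<nu>"
  then show "quasi_herglotz q" using quasi_herglotz_of_representation by blast
qed

end
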